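(* For an admissible control policy $\mu\in\Pi$, let $J_\mu:[0,\bar s]\times[0,B]\to\mathbb R$ be the cost function conditioned on a first shock at time $0$ (defined in the context). A function $J:[0,\bar s]\times[0,B]\to\mathbb R$ satisfies $$J(s,w)=J^*(s,w):=\min_{\mu\in\Pi}J_\mu(s,w)\qquad\text{for all }(s,w)$$ if and only if it satisfies the fixed-point equation $$J(s,w)=(TJ)(s,w):=\min_{u\in[0,\min\{s,w\}]}\Big\{g(w-u)+\mathbf E\big[e^{-\theta t_0}J\big(\min\{s-u+rt_0,\bar s\},W\big)\big]\Big\},$$ where $t_0$ is an exponential random variable with mean $1/Q$ independent of $W$. Moreover, a stationary policy $\mu^*(s,w)$ is optimal if and only if $u=\mu^*(s,w)$ achieves the minimum in this equation for $J=J^*$. Finally, the value iteration algorithm $J_{k+1}=TJ_k$ converges to $J^*$ for any initial condition $J_0$.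
   Context: Model. Fix constants $r>0$ (storage ramp rate), $Q>0$ (Poisson arrival rate), $\theta>0$ (discount rate), $\bar s\in(0,\infty)$ (storage capacity), $B\in(0,\infty)$. Shocks arrive at the arrival times $0<t_1<t_2<\cdots$ of a Poisson process of rate $Q$; the shock sizes $W_1,W_2,\dots$ are i.i.d. with a distribution $f_W$ supported in $[0,B]$ and independent of the arrival times; $W$ denotes a generic random variable with distribution $f_W$. A (stationary Markov) policy is a measurable function $\mu:[0,\bar s]\times[0,B]\to\mathbb R$ with $0\le\mu(s,w)\le\min\{s,w\}$; the set of all (admissible) policies is $\Pi$. Under policy $\mu$ from initial state $s_0=s\in[0,\bar s]$, the storage level $s_t\in[0,\bar s]$ increases at rate $r$ between arrivals until it reaches $\bar s$, where it stays until the next arrival, and at each arrival time $t_k$ it jumps down: $s_{t_k}=s_{t_k^-}-\mu(s_{t_k^-},W_k)$. The stage cost $g:[0,B]\to\mathbb R$ is bounded, strictly increasing, continuously differentiable, with $g(0)=0$ and $\mathbf E[g(W)]>0$. The cost of policy $\mu$ is $$C_\mu(s)=\mathbf E\Big[\sum_{k=1}^\infty e^{-\theta t_k}\,g\big(W_k-\mu(s_{t_k^-},W_k)\big)\,\Big|\,s_0=s\Big],\qquad 0\le s\le\bar s,$$ and a policy $\mu^*\in\Pi$ is optimal if $\mu^*\in\arg\min_{\mu\in\Pi}C_\mu(s)$. For $\mu\in\Pi$, $J_\mu(s,w)$ is the expected discounted cost conditioned on the first shock arriving at time $0$ and being of size $w$, with storage level $s$ just before it: $$J_\mu(s,w)=g(w-\mu(s,w))+\mathbf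 E\Big[\sum_{k=1}^\infty e^{-\theta t_k}\,g\big(W_k-\mu(s_{t_k^-},W_k)\big)\,\Big|\,s_0=s-\mu(s,w)\Big].$$
   Formalization: Optimality for C_μ (all initial s) is shown equivalent to achieving the minimum for almost every (s,w) and, at s = s̄, for almost every w, since C_μ ignores null sets; achieving it at every (s,w) is shown equivalent to J_μ = J*. J and J_0 must have the expectations in T. *)

theory Defs
  imports "HOL-Probability.Probability"
begin

record storage_system =
  ramp_rate :: real
  shock_rate :: real
  discount_rate :: real
  capacity :: real
  max_shock :: real
  size_law :: "real measure"
  stage_cost :: "real \<Rightarrow> real"

definition storage_model :: "storage_system \<Rightarrow> bool" where
  "storage_model S \<longleftrightarrow>
     0 < ramp_rate S \<and> 0 < shock_rate S \<and> 0 < discount_rate S \<and>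
     0 < capacity S \<and> 0 < max_shock S \<and>
     prob_space (size_law S) \<and> sets (size_law S) = sets borel \<and>
     (AE w in size_law S. w \<in> {0..max_shock S}) \<and>
     bounded (stage_cost S ` {0..max_shock S}) \<and>
     strict_mono_on {0..max_shock S} (stage_cost S) \<and>
     (\<exists>g'. continuous_on {0..max_shock S} g' \<and>
        (\<forall>x\<in>{0..max_shock S}.
           (stage_cost S has_real_derivative g' x) (at x within {0..max_shock S}))) \<and>
     stage_cost S 0 = 0 \<and>
     0 < (LINT w:{0..max_shock S}|size_law S. stage_cost S w)"

definition gap_law :: "storage_system \<Rightarrow> real measure" where
  "gap_law S = density lborel (\<lambda>t. ennreal (exponential_density (shock_rate S) t))"

text \<open>
  The Poisson process is given by its independent exponential interarrival times. Shocks are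
  numbered from 0: \<open>W k\<close> is the size of the shock at the arrival time
  \<open>arrival_time \<tau> k \<omega> = \<tau> 0 \<omega> + \<dots> + \<tau> k \<omega>\<close>. Interarrival times are positive and sizes lie
  in \<open>[0, B]\<close> on every sample path, as policies and the stage cost are unconstrained outside
  their domains.
\<close>

definition shock_process ::
    "storage_system \<Rightarrow> 'a measure \<Rightarrow> (nat \<Rightarrow> 'a \<Rightarrow> real) \<Rightarrow> (nat \<Rightarrow> 'a \<Rightarrow> real) \<Rightarrow> bool" where
  "shock_process S M \<tau> W \<longleftrightarrow>
     prob_space M \<and>
     prob_space.indep_vars M (\<lambda>_. borel) (case_sum \<tau> W) UNIV \<and>
     (\<forall>k. distr M borel (\<tau> k) = gap_law S) \<and>
     (\<forall>k. distr M borel (W k) = size_law S) \<and>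
     (\<forall>k. \<forall>\<omega>\<in>space M. 0 < \<tau> k \<omega> \<and> W k \<omega> \<in> {0..max_shock S})"

definition arrival_time :: "(nat \<Rightarrow> 'a \<Rightarrow> real) \<Rightarrow> nat \<Rightarrow> 'a \<Rightarrow> real" where
  "arrival_time \<tau> k \<omega> = (\<Sum>j\<le>k. \<tau> j \<omega>)"

definition policies :: "storage_system \<Rightarrow> (real \<Rightarrow> real \<Rightarrow> real) set" where
  "policies S = {\<mu>.
     (\<lambda>(s, w). \<mu> s w) \<in> borel_measurable (restrict_space borel ({0..capacity S} \<times> {0..max_shock S})) \<and>
     (\<forall>s\<in>{0..capacity S}. \<forall>w\<in>{0..max_shock S}. 0 \<le> \<mu> s w \<and> \<mu> s w \<le> min s w)}"

definition refill :: "storage_system \<Rightarrow> real \<Rightarrow> real \<Rightarrow> real" where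
  "refill S x t = min (x + ramp_rate S * t) (capacity S)"

text \<open>
  \<open>level_before k\<close> is the storage level just before the shock with index \<open>k\<close> (the left limit of
  the level at that arrival time) when the policy \<open>\<mu>\<close> is used and the initial level is \<open>s\<close>.
\<close>

primrec level_before ::
    "storage_system \<Rightarrow> (nat \<Rightarrow> 'a \<Rightarrow> real) \<Rightarrow> (nat \<Rightarrow> 'a \<Rightarrow> real) \<Rightarrow> (real \<Rightarrow> real \<Rightarrow> real) \<Rightarrow>
     real \<Rightarrow> 'a \<Rightarrow> nat \<Rightarrow> real" where
  "level_before S \<tau> W \<mu> s \<omega> 0 = refill S s (\<tau> 0 \<omega>)"
| "level_before S \<tau> W \<mu> s \<omega> (Suc k) =
     refill S (level_before S \<tau> W \<mu> s \<omega> k - \<mu> (level_before S \<tau> W \<mu> s \<omega> k) (W k \<omega>)) (\<tau> (Suc k) \<omega>)"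

definition policy_cost ::
    "storage_system \<Rightarrow> 'a measure \<Rightarrow> (nat \<Rightarrow> 'a \<Rightarrow> real) \<Rightarrow> (nat \<Rightarrow> 'a \<Rightarrow> real) \<Rightarrow>
     (real \<Rightarrow> real \<Rightarrow> real) \<Rightarrow> real \<Rightarrow> real" where
  "policy_cost S M \<tau> W \<mu> s =
     (LINT \<omega>|M. (\<Sum>k. exp (- discount_rate S * arrival_time \<tau> k \<omega>) *
        stage_cost S (W k \<omega> - \<mu> (level_before S \<tau> W \<mu> s \<omega> k) (W k \<omega>))))"

definition optimal_policy ::
    "storage_system \<Rightarrow> 'a measure \<Rightarrow> (nat \<Rightarrow> 'a \<Rightarrow> real) \<Rightarrow> (nat \<Rightarrow> 'a \<Rightarrow> real) \<Rightarrow>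
     (real \<Rightarrow> real \<Rightarrow> real) \<Rightarrow> bool" where
  "optimal_policy S M \<tau> W \<mu> \<longleftrightarrow>
     (\<forall>s\<in>{0..capacity S}. is_arg_min (\<lambda>\<nu>. policy_cost S M \<tau> W \<nu> s) (\<lambda>\<nu>. \<nu> \<in> policies S) \<mu>)"

definition shock_cost ::
    "storage_system \<Rightarrow> 'a measure \<Rightarrow> (nat \<Rightarrow> 'a \<Rightarrow> real) \<Rightarrow> (nat \<Rightarrow> 'a \<Rightarrow> real) \<Rightarrow>
     (real \<Rightarrow> real \<Rightarrow> real) \<Rightarrow> real \<Rightarrow> real \<Rightarrow> real" where
  "shock_cost S M \<tau> W \<mu> s w =
     stage_cost S (w - \<mu> s w) + policy_cost S M \<tau> W \<mu> (s - \<mu> s w)"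

text \<open>
  \<open>minimum f A\<close> is unspecified if the minimum is not attained.
\<close>

definition attains_minimum :: "('b \<Rightarrow> real) \<Rightarrow> 'b set \<Rightarrow> bool" where
  "attains_minimum f A \<longleftrightarrow> (\<exists>x. is_arg_min f (\<lambda>y. y \<in> A) x)"

definition minimum :: "('b \<Rightarrow> real) \<Rightarrow> 'b set \<Rightarrow> real" where
  "minimum f A = (LEAST c. c \<in> f ` A)"

definition optimal_shock_cost ::
    "storage_system \<Rightarrow> 'a measure \<Rightarrow> (nat \<Rightarrow> 'a \<Rightarrow> real) \<Rightarrow> (nat \<Rightarrow> 'a \<Rightarrow> real) \<Rightarrow>
     real \<Rightarrow> real \<Rightarrow> real" where
  "optimal_shock_cost S M \<tau> W s w = minimum (\<lambda>\<mu>. shock_cost S M \<tau> W \<mu> s w) (policies S)"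

text \<open>
  The expectation over an independent exponential time and shock size is an integral over the
  product of their laws. The integral is taken over the full-measure set \<open>[0, \<infinity>) \<times> [0, B]\<close> so that
  values of \<open>J\<close> outside its domain \<open>[0, capacity] \<times> [0, B]\<close> are irrelevant.
\<close>

definition expected_continuation ::
    "storage_system \<Rightarrow> (real \<Rightarrow> real \<Rightarrow> real) \<Rightarrow> real \<Rightarrow> real" where
  "expected_continuation S J x =
     (LINT p:{0..} \<times> {0..max_shock S}|gap_law S \<Otimes>\<^sub>M size_law S.
        exp (- discount_rate S * fst p) * J (refill S x (fst p)) (snd p))"

text \<open>
  The Bochner integral of a non-integrable function is 0, so that the existence of the
  expectations occurring in the Bellman operator has to be required separately. Existence
  includes measurability of \<open>J\<close> on its domain.
\<close>

definition continuation_exists :: "storage_system \<Rightarrow> (real \<Rightarrow> real \<Rightarrow> real) \<Rightarrow> bool" where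
  "continuation_exists S J \<longleftrightarrow>
     (\<forall>x\<in>{0..capacity S}.
        set_integrable (gap_law S \<Otimes>\<^sub>M size_law S) ({0..} \<times> {0..max_shock S})
          (\<lambda>p. exp (- discount_rate S * fst p) * J (refill S x (fst p)) (snd p)))"

definition action_cost ::
    "storage_system \<Rightarrow> (real \<Rightarrow> real \<Rightarrow> real) \<Rightarrow> real \<Rightarrow> real \<Rightarrow> real \<Rightarrow> real" where
  "action_cost S J s w u = stage_cost S (w - u) + expected_continuation S J (s - u)"

definition bellman ::
    "storage_system \<Rightarrow> (real \<Rightarrow> real \<Rightarrow> real) \<Rightarrow> real \<Rightarrow> real \<Rightarrow> real" where
  "bellman S J s w = minimum (action_cost S J s w) {0..min s w}"

definition achieves_minimum ::
    "storage_system \<Rightarrow> (real \<Rightarrow> real \<Rightarrow> real) \<Rightarrow> (real \<Rightarrow> real \<Rightarrow> real) \<Rightarrow> real \<Rightarrow> real \<Rightarrow> bool" where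
  "achieves_minimum S J \<mu> s w \<longleftrightarrow>
     is_arg_min (action_cost S J s w) (\<lambda>u. u \<in> {0..min s w}) (\<mu> s w)"

end

theory Submission
  imports Defs
begin

text \<open>
  Write \<open>V x = E[e\<^bsup>-\<theta>t\<^esup> J (min {x + r t, cap}, W)]\<close> for the expected continuation of \<open>J\<close>. Everything
  rests on three facts.

  First, the Bellman operator sees \<open>J\<close> only through \<open>V\<close>, and \<open>V\<close> is continuous on \<open>[0, cap]\<close> for
  every \<open>J\<close> whose expectations exist, however irregular or unbounded, because exponential waiting
  times smooth \<open>J\<close> (\<open>continuous_expected_continuation\<close>). Hence the minima over actions are attained,
  and minimisers can be chosen measurably, so that they form a policy (\<open>greedy_policy_exists\<close>).

  Second, \<open>J \<mapsto> V\<close> contracts the supremum norm by \<open>Q / (Q + \<theta>) < 1\<close> and minimisation does not expand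
  it. Banach's theorem gives a fixed point \<open>J\<close>; contraction gives its uniqueness and the uniform
  convergence of value iteration, from any start, since one step makes every starting point bounded.

  Third, for a fixed point \<open>J\<close> and any policy \<open>\<mu>\<close> let the Bellman gap \<open>d (s, w) \<ge> 0\<close> be the amount by
  which the action \<open>\<mu> s w\<close> misses the minimum in the fixed-point equation. Conditioning each shock
  on its past and telescoping gives the performance difference formula
  \<open>C\<^sub>\<mu> x = V x + (\<Sum>k. E[e\<^bsup>-\<theta>t\<^sub>k\<^esup> d (level before shock k, size of shock k)])\<close>
  (\<open>performance_difference\<close>). It yields all statements on optimality at once: no policy beats \<open>V\<close>, a
  policy without gaps attains it, so \<open>J\<close> is the optimal cost conditioned on a shock at time 0, and a
  policy is optimal from every initial level iff its gaps are invisible to the process. The law of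
  the level before a shock has a density below the full level and an atom at it, which is why
  invisibility means being zero almost everywhere together with being zero for almost every shock
  at the full level (\<open>expected_continuation_zero_AE\<close>).
\<close>

section \<open>Attained minima and measurable minimisers\<close>

lemma minimum_eqI:
  assumes "x \<in> A" "\<And>y. y \<in> A \<Longrightarrow> f x \<le> f y"
  shows "minimum f A = f x"
  unfolding minimum_def by (rule Least_equality) (use assms in auto)

lemma is_arg_min_iff: "is_arg_min f (\<lambda>y. y \<in> A) x \<longleftrightarrow> x \<in> A \<and> (\<forall>y\<in>A. f x \<le> f y)" for f :: "'b \<Rightarrow> real"
  by (auto simp: is_arg_min_def not_less)

text \<open>
  The selected minimiser is the least one, \<open>L p\<close>. By compactness \<open>L p \<le> a\<close> holds iff the minimum over
  \<open>[0, a]\<close> does not exceed the minimum over \<open>[0, 1]\<close>, and by continuity both minima can be compared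
  on a countable dense set. Parametrising \<open>[0, a]\<close> as \<open>a * l\<close> with \<open>l \<in> [0, 1]\<close> allows one dense set
  \<open>D\<close> to serve for all \<open>a\<close>.
\<close>

lemma measurable_compact_selection:
  fixes G :: "'b \<Rightarrow> real \<Rightarrow> real"
  assumes [measurable]: "\<And>l. l \<in> {0..1} \<Longrightarrow> (\<lambda>p. G p l) \<in> borel_measurable N"
    and cont: "\<And>p. p \<in> space N \<Longrightarrow> continuous_on {0..1} (G p)"
  obtains L where "L \<in> borel_measurable N" "\<And>p. p \<in> space N \<Longrightarrow> L p \<in> {0..1}"
    "\<And>p l. p \<in> space N \<Longrightarrow> l \<in> {0..1} \<Longrightarrow> G p (L p) \<le> G p l"
proof -
  obtain D :: "real set" where D: "countable D" "D \<subseteq> {0..1}" "{0..1} \<subseteq> closure D"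
    by (rule separable)
  have clD: "closure D = {0..1}"
    using D(3) closure_minimal[OF D(2)] by auto
  have dense: "K \<le> f l" if "continuous_on {0..1} f" "\<And>q. q \<in> D \<Longrightarrow> K \<le> f q" "l \<in> {0..1}"
    for f :: "real \<Rightarrow> real" and K l
    using continuous_ge_on_closure[of D f l K] that unfolding clD by auto
  define Mn where "Mn p = {l \<in> {0..1}. \<forall>l'\<in>{0..1}. G p l \<le> G p l'}" for p
  define L where "L p = Inf (Mn p)" for p
  have LMn: "L p \<in> Mn p" and L_least: "\<And>l. l \<in> Mn p \<Longrightarrow> L p \<le> l" if p: "p \<in> space N" for p
  proof -
    obtain l where l: "l \<in> {0..1}" "\<forall>l'\<in>{0..1}. G p l \<le> G p l'"
      using continuous_attains_inf[OF compact_Icc _ cont[OF p]] by fastforce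
    have eq: "Mn p = {0..1} \<inter> (G p) -` {..G p l}"
      unfolding Mn_def using l by (auto intro: order_trans)
    have "closed (Mn p)"
      unfolding eq using cont[OF p] by (intro continuous_closed_preimage) auto
    moreover have bdd: "bdd_below (Mn p)"
      unfolding Mn_def by (rule bdd_belowI[of _ 0]) auto
    ultimately show "L p \<in> Mn p"
      unfolding L_def using l by (intro closed_contains_Inf) (auto simp: Mn_def)
    show "L p \<le> l" if "l \<in> Mn p" for l
      unfolding L_def using that bdd by (rule cInf_lower)
  qed
  have sublevel: "L p \<le> a \<longleftrightarrow> (\<forall>q\<in>D. \<forall>n::nat. \<exists>l\<in>D. G p (a * l) < G p q + 1 / Suc n)"
    if p: "p \<in> space N" and a: "0 \<le> a" "a \<le> 1" for p a
  proof
    have conta: "continuous_on {0..1} (\<lambda>l. G p (a * l))"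
    proof (rule continuous_on_compose2[OF cont[OF p]])
      show "continuous_on {0..1} (\<lambda>l. a * l)" by (intro continuous_intros)
      show "(\<lambda>l. a * l) ` {0..1} \<subseteq> {0..1}" using a by (auto intro: mult_le_one)
    qed
    {
      assume le: "L p \<le> a"
      show "\<forall>q\<in>D. \<forall>n::nat. \<exists>l\<in>D. G p (a * l) < G p q + 1 / Suc n"
      proof (intro ballI allI, rule ccontr)
        fix q n assume q: "q \<in> D" and "\<not> (\<exists>l\<in>D. G p (a * l) < G p q + 1 / Suc n)"
        then have "\<And>l. l \<in> D \<Longrightarrow> G p q + 1 / Suc n \<le> G p (a * l)"
          by (meson not_less)
        then have K: "G p q + 1 / Suc n \<le> G p (a * l)" if "l \<in> {0..1}" for l
          using dense[of "\<lambda>l. G p (a * l)"] conta that by blast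
        obtain l where l: "l \<in> {0..1}" "L p = a * l"
        proof (cases "a = 0")
          case True
          then show ?thesis using that[of 0] le LMn[OF p] by (auto simp: Mn_def)
        next
          case False
          then show ?thesis using that[of "L p / a"] le LMn[OF p] a by (auto simp: Mn_def)
        qed
        have "G p (L p) \<le> G p q"
          using LMn[OF p] q D(2) by (auto simp: Mn_def)
        moreover have "G p q < G p q + 1 / Suc n" by simp
        ultimately show False using K[OF l(1)] l(2) by simp
      qed
    next
      assume *: "\<forall>q\<in>D. \<forall>n::nat. \<exists>l\<in>D. G p (a * l) < G p q + 1 / Suc n"
      obtain l where l: "l \<in> {0..1}" "\<forall>l'\<in>{0..1}. G p (a * l) \<le> G p (a * l')"
        using continuous_attains_inf[OF compact_Icc _ conta] by fastforce
      have "G p (a * l) \<le> G p q" if q: "q \<in> D" for q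
      proof (rule field_le_epsilon)
        fix e :: real assume "0 < e"
        then obtain n where n: "1 / Suc n < e"
          using nat_approx_posE by blast
        obtain l' where "l' \<in> D" "G p (a * l') < G p q + 1 / Suc n"
          using * q by blast
        then show "G p (a * l) \<le> G p q + e"
          using l(2) D(2) n by fastforce
      qed
      then have "a * l \<in> Mn p"
        unfolding Mn_def using l(1) a dense[OF cont[OF p]] by (auto intro: mult_le_one)
      then have "L p \<le> a * l" by (rule L_least[OF p])
      also have "\<dots> \<le> a" using l(1) a by (simp add: mult_left_le)
      finally show "L p \<le> a" .
    }
  qed
  have "L \<in> borel_measurable N"
    unfolding borel_measurable_iff_le
  proof
    fix a :: real
    consider "a < 0" | "1 < a" | "0 \<le> a" "a \<le> 1" by linarith
    then show "{p \<in> space N. L p \<le> a} \<in> sets N"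
    proof cases
      case 1
      then have eq: "{p \<in> space N. L p \<le> a} = {}"
        using LMn by (force simp: Mn_def)
      then show ?thesis unfolding eq by simp
    next
      case 2
      then have eq: "{p \<in> space N. L p \<le> a} = space N"
        using LMn by (force simp: Mn_def)
      then show ?thesis unfolding eq by simp
    next
      case 3
      have aD: "a * l \<in> {0..1}" if "l \<in> D" for l
      proof -
        have "l \<in> {0..1}" using that D(2) by blast
        then show ?thesis using 3 by (auto intro: mult_le_one)
      qed
      have less: "{p \<in> space N. G p (a * l) < G p q + 1 / Suc n} \<in> sets N" if "l \<in> D" "q \<in> D" for l q n
      proof -
        have q: "q \<in> {0..1}" using that(2) D(2) by blast
        note [measurable] = assms(1)[OF aD[OF that(1)]] assms(1)[OF q]
        show ?thesis by measurable
      qed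
      have "{p \<in> space N. L p \<le> a} =
          {p \<in> space N. \<forall>q\<in>D. \<forall>n::nat. \<exists>l\<in>D. G p (a * l) < G p q + 1 / Suc n}"
        using sublevel[OF _ 3] by blast
      also have "\<dots> \<in> sets N"
        by (intro sets.sets_Collect_countable_All' sets.sets_Collect_countable_All
            sets.sets_Collect_countable_Ex' D(1) less)
      finally show ?thesis .
    qed
  qed
  then show ?thesis
    using LMn by (intro that) (auto simp: Mn_def)
qed

section \<open>The storage model\<close>

text \<open>
  Projection onto \<open>[0, b]\<close>. Costs and policies are constrained on their domains only; composing
  them with projections yields measurable or continuous functions on the whole line that agree with
  them where it matters.
\<close>

definition clip :: "real \<Rightarrow> real \<Rightarrow> real" where
  "clip b x = max 0 (min b x)"

lemma continuous_on_clip [continuous_intros]: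
  "continuous_on A f \<Longrightarrow> continuous_on A (\<lambda>x. clip b (f x))"
  unfolding clip_def by (intro continuous_intros)

lemma measurable_clip [measurable]: "clip b \<in> borel_measurable borel"
  unfolding clip_def by measurable

lemma clip_in: "0 \<le> b \<Longrightarrow> clip b x \<in> {0..b}"
  by (auto simp: clip_def)

lemma clip_id [simp]: "x \<in> {0..b} \<Longrightarrow> clip b x = x"
  by (auto simp: clip_def)

locale storage =
  fixes S :: storage_system
  assumes model: "storage_model S"
begin

abbreviation "levels \<equiv> {0..capacity S}"
abbreviation "sizes \<equiv> {0..max_shock S}"
abbreviation "law \<equiv> gap_law S \<Otimes>\<^sub>M size_law S"

lemma params_pos: "0 < ramp_rate S" "0 < shock_rate S" "0 < discount_rate S"
    "0 < capacity S" "0 < max_shock S"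
  using model by (auto simp: storage_model_def)

lemma zero_in [simp]: "0 \<in> levels" "capacity S \<in> levels" "0 \<in> sizes"
  using params_pos by auto

lemma clip_in_domain: "clip (capacity S) x \<in> levels" "clip (max_shock S) x \<in> sizes"
  using params_pos by (auto intro!: clip_in simp del: atLeastAtMost_iff)

lemma prob_size: "prob_space (size_law S)" and sets_size [measurable_cong, simp]: "sets (size_law S) = sets borel"
  and AE_size: "AE w in size_law S. w \<in> sizes"
  using model by (auto simp: storage_model_def)

lemma sets_gap [measurable_cong, simp]: "sets (gap_law S) = sets borel"
  by (simp add: gap_law_def)

lemma prob_gap: "prob_space (gap_law S)"
  unfolding gap_law_def by (rule prob_space_exponential_density) (rule params_pos)

sublocale gap: prob_space "gap_law S" by (rule prob_gap)
sublocale size: prob_space "size_law S" by (rule prob_size)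
sublocale both: pair_prob_space "gap_law S" "size_law S" ..

lemma stage_cost_cont: "continuous_on sizes (stage_cost S)"
proof -
  have "\<forall>x\<in>sizes. \<exists>D. (stage_cost S has_real_derivative D) (at x within sizes)"
    using model by (auto simp: storage_model_def)
  then show ?thesis
    by (metis DERIV_continuous_on)
qed

lemma refill_in: "x \<in> levels \<Longrightarrow> 0 \<le> t \<Longrightarrow> refill S x t \<in> levels"
  using params_pos by (auto simp: refill_def)

lemma measurable_refill [measurable]:
  assumes [measurable]: "f \<in> borel_measurable N" "h \<in> borel_measurable N"
  shows "(\<lambda>p. refill S (f p) (h p)) \<in> borel_measurable N"
  unfolding refill_def by measurable

section \<open>The expected continuation\<close>

definition continuation_integrand :: "(real \<Rightarrow> real \<Rightarrow> real) \<Rightarrow> real \<Rightarrow> real \<times> real \<Rightarrow> real" where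
  "continuation_integrand J x p = indicator ({0..} \<times> sizes) p *
     (exp (- discount_rate S * fst p) * J (refill S x (fst p)) (snd p))"

lemma expected_continuation_eq: "expected_continuation S J x = integral\<^sup>L law (continuation_integrand J x)"
  unfolding expected_continuation_def set_lebesgue_integral_def continuation_integrand_def by simp

lemma continuation_exists_eq:
  "continuation_exists S J \<longleftrightarrow> (\<forall>x\<in>levels. integrable law (continuation_integrand J x))"
  unfolding continuation_exists_def set_integrable_def
  by (intro ball_cong refl) (simp add: continuation_integrand_def[abs_def])

lemma continuation_integrand_cong:
  assumes "x \<in> levels" "\<And>s w. s \<in> levels \<Longrightarrow> w \<in> sizes \<Longrightarrow> J s w = J' s w"
  shows "continuation_integrand J x p = continuation_integrand J' x p"
  using assms refill_in[of x "fst p"] by (cases p) (auto simp: continuation_integrand_def indicator_def)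

lemma expected_continuation_cong:
  assumes "x \<in> levels" "\<And>s w. s \<in> levels \<Longrightarrow> w \<in> sizes \<Longrightarrow> J s w = J' s w"
  shows "expected_continuation S J x = expected_continuation S J' x"
proof -
  have "continuation_integrand J x = continuation_integrand J' x"
    by (rule ext, rule continuation_integrand_cong) (use assms in blast)+
  then show ?thesis
    unfolding expected_continuation_eq by simp
qed

lemma continuation_exists_cong:
  assumes "\<And>s w. s \<in> levels \<Longrightarrow> w \<in> sizes \<Longrightarrow> J s w = J' s w"
  shows "continuation_exists S J \<longleftrightarrow> continuation_exists S J'"
proof -
  have "continuation_integrand J x = continuation_integrand J' x" if "x \<in> levels" for x
    by (rule ext, rule continuation_integrand_cong) (use that assms in blast)+
  then show ?thesis
    unfolding continuation_exists_eq by auto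
qed

definition mean_over_size :: "(real \<Rightarrow> real \<Rightarrow> real) \<Rightarrow> real \<Rightarrow> real" where
  "mean_over_size J y = (\<integral>w. indicator sizes w * J y w \<partial>size_law S)"

text \<open>
  The integrand of the expected continuation after integrating out the shock size: a density on the
  waiting time until the next shock.
\<close>

definition gap_integrand :: "(real \<Rightarrow> real \<Rightarrow> real) \<Rightarrow> real \<Rightarrow> real \<Rightarrow> real" where
  "gap_integrand J x t = exponential_density (shock_rate S) t *
     (indicator {0..} t * exp (- discount_rate S * t) * mean_over_size J (refill S x t))"

lemma expected_continuation_iterated:
  assumes "integrable law (continuation_integrand J x)"
  shows "integrable lborel (gap_integrand J x)"
    and "expected_continuation S J x = integral\<^sup>L lborel (gap_integrand J x)"
proof -
  have inner: "(\<integral>w. continuation_integrand J x (t, w) \<partial>size_law S) =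
      indicator {0..} t * exp (- discount_rate S * t) * mean_over_size J (refill S x t)" for t
    unfolding mean_over_size_def continuation_integrand_def integral_mult_right_zero[symmetric]
    by (rule Bochner_Integration.integral_cong) (auto simp: indicator_def)
  have int: "integrable (gap_law S) (\<lambda>t. \<integral>w. continuation_integrand J x (t, w) \<partial>size_law S)"
    by (rule both.integrable_fst'[OF assms])
  then have "(\<lambda>t. \<integral>w. continuation_integrand J x (t, w) \<partial>size_law S) \<in> borel_measurable borel"
    using borel_measurable_integrable measurable_cong_sets[OF sets_gap refl] by auto
  then have [measurable]: "(\<lambda>t. indicator {0..} t * exp (- (discount_rate S * t)) *
      mean_over_size J (refill S x t)) \<in> borel_measurable borel"
    unfolding inner by simp
  have nn: "AE t in lborel. 0 \<le> exponential_density (shock_rate S) t"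
    using params_pos by (auto simp: exponential_density_def)
  from int show "integrable lborel (gap_integrand J x)"
    unfolding gap_law_def gap_integrand_def[abs_def]
    by (subst (asm) integrable_density) (use nn in \<open>simp_all add: inner\<close>)
  have "expected_continuation S J x = (\<integral>t. (\<integral>w. continuation_integrand J x (t, w) \<partial>size_law S) \<partial>gap_law S)"
    unfolding expected_continuation_eq by (rule both.integral_fst'[OF assms, symmetric])
  also have "\<dots> = integral\<^sup>L lborel (gap_integrand J x)"
    unfolding gap_law_def gap_integrand_def[abs_def]
    by (subst integral_density) (use nn in \<open>simp_all add: inner\<close>)
  finally show "expected_continuation S J x = integral\<^sup>L lborel (gap_integrand J x)" .
qed

text \<open>
  Memorylessness: starting empty and having waited for the time \<open>x / r\<close> it takes to reach the level
  \<open>x\<close> is the same as starting from \<open>x\<close>, up to the discounted probability that no shock occurred.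
\<close>

lemma gap_integrand_shift:
  assumes "0 \<le> x" "0 < t"
  shows "gap_integrand J 0 (x / ramp_rate S + t) =
    exp (- (shock_rate S + discount_rate S) * (x / ramp_rate S)) * gap_integrand J x t"
proof -
  have "refill S 0 (x / ramp_rate S + t) = refill S x t"
  proof -
    have "ramp_rate S * (x / ramp_rate S + t) = x + ramp_rate S * t"
      using params_pos by (simp add: distrib_left)
    then show ?thesis by (simp add: refill_def)
  qed
  moreover have "\<not> x / ramp_rate S + t < 0" "0 \<le> x / ramp_rate S + t"
    using assms params_pos by (auto simp: not_less intro!: add_nonneg_nonneg)
  ultimately show ?thesis
    using assms unfolding gap_integrand_def exponential_density_def
    by (simp add: exp_add[symmetric] algebra_simps)
qed

text \<open>
  By memorylessness the expected continuations from all levels are governed by the single integrable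
  function \<open>\<phi>\<close> belonging to the empty storage: with \<open>a = Q + \<theta>\<close>,
  \<open>V x = e\<^bsup>a x / r\<^esup> (V 0 - integral of \<phi> over [0, x / r])\<close>,
  and indefinite integrals are continuous.
\<close>

lemma continuous_expected_continuation:
  assumes J: "continuation_exists S J"
  shows "continuous_on levels (expected_continuation S J)"
proof -
  let ?r = "ramp_rate S" and ?\<phi> = "gap_integrand J" and ?a = "shock_rate S + discount_rate S"
  have int: "integrable lborel (?\<phi> x)" and ec: "expected_continuation S J x = integral\<^sup>L lborel (?\<phi> x)"
    if "x \<in> levels" for x
    using J that expected_continuation_iterated by (auto simp: continuation_exists_eq)
  have [measurable]: "?\<phi> x \<in> borel_measurable borel" if "x \<in> levels" for x
    using borel_measurable_integrable[OF int[OF that]] by simp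
  note m0[measurable] = this[OF zero_in(1)]
  have formula: "expected_continuation S J x =
      exp (?a * (x / ?r)) * (expected_continuation S J 0 - integral {0..x / ?r} (?\<phi> 0))"
    if x: "x \<in> levels" for x
  proof -
    let ?d = "x / ?r"
    have d: "0 \<le> ?d" using x params_pos by auto
    note mx[measurable] = \<open>x \<in> levels \<Longrightarrow> ?\<phi> x \<in> borel_measurable borel\<close>[OF x]
    have i: "integrable lborel (\<lambda>t. indicator A t * ?\<phi> 0 t)" if "A \<in> sets borel" for A
      using integrable_mult_indicator[OF _ int[OF zero_in(1)], of A] that by simp
    have "expected_continuation S J 0 = (\<integral>t. indicator {0..?d} t * ?\<phi> 0 t + indicator {?d<..} t * ?\<phi> 0 t \<partial>lborel)"
      unfolding ec[OF zero_in(1)] using d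
      by (intro Bochner_Integration.integral_cong) (auto simp: indicator_def gap_integrand_def)
    also have "\<dots> = (\<integral>t. indicator {0..?d} t * ?\<phi> 0 t \<partial>lborel) + (\<integral>t. indicator {?d<..} t * ?\<phi> 0 t \<partial>lborel)"
      by (rule Bochner_Integration.integral_add) (auto intro: i)
    also have "(\<integral>t. indicator {0..?d} t * ?\<phi> 0 t \<partial>lborel) = integral {0..?d} (?\<phi> 0)"
      using set_borel_integral_eq_integral(2)[of "{0..?d}" "?\<phi> 0"] i[of "{0..?d}"]
      by (simp add: set_integrable_def set_lebesgue_integral_def)
    \<comment> \<open>the part after time \<open>x / r\<close> is shifted to start at 0, where memorylessness applies\<close>
    also have "(\<integral>t. indicator {?d<..} t * ?\<phi> 0 t \<partial>lborel) =
        (\<integral>t. indicator {?d<..} (?d + t) * ?\<phi> 0 (?d + t) \<partial>lborel)"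
      using lborel_integral_real_affine[of 1 "\<lambda>t. indicator {?d<..} t * ?\<phi> 0 t" ?d] by simp
    also have "\<dots> = (\<integral>t. exp (- ?a * ?d) * ?\<phi> x t \<partial>lborel)"
    \<comment> \<open>the two sides differ at \<open>t = 0\<close>, the left one being cut off there\<close>
    proof (rule integral_cong_AE)
      have "AE t in lborel. t \<noteq> (0::real)" by (rule AE_lborel_singleton)
      then show "AE t in lborel. indicator {?d<..} (?d + t) * ?\<phi> 0 (?d + t) = exp (- ?a * ?d) * ?\<phi> x t"
      proof eventually_elim
        case (elim t)
        show ?case
        proof (cases "0 < t")
          case True
          then show ?thesis using gap_integrand_shift[of x t J] x by simp
        next
          case False
          then show ?thesis using elim by (auto simp: gap_integrand_def)
        qed
      qed
    qed measurable
    also have "\<dots> = exp (- ?a * ?d) * expected_continuation S J x"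
      unfolding ec[OF x] by simp
    finally have "expected_continuation S J 0 - integral {0..?d} (?\<phi> 0) = exp (- ?a * ?d) * expected_continuation S J x"
      by simp
    moreover have "exp (?a * ?d) * exp (- ?a * ?d) = 1"
      unfolding exp_add[symmetric] by (simp only: mult_minus_left add.right_inverse exp_zero)
    ultimately show ?thesis
      by (metis mult.assoc mult_1)
  qed
  have "(?\<phi> 0) integrable_on {0..capacity S / ?r}"
    using set_borel_integral_eq_integral(1)[of "{0..capacity S / ?r}" "?\<phi> 0"]
      integrable_mult_indicator[OF _ int[OF zero_in(1)], of "{0..capacity S / ?r}"]
    by (simp add: set_integrable_def)
  then have "continuous_on {0..capacity S / ?r} (\<lambda>d. integral {0..d} (?\<phi> 0))"
    by (rule indefinite_integral_continuous_1)
  then have "continuous_on levels (\<lambda>x. integral {0..x / ?r} (?\<phi> 0))"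
    by (rule continuous_on_compose2[where f="\<lambda>x. x / ?r"])
      (use params_pos in \<open>auto intro!: continuous_intros divide_right_mono\<close>)
  then have "continuous_on levels (\<lambda>x. exp (?a * (x / ?r)) * (expected_continuation S J 0 - integral {0..x / ?r} (?\<phi> 0)))"
    using params_pos by (intro continuous_intros) auto
  then show ?thesis
    by (subst continuous_on_cong[OF refl formula])
qed


text \<open>
  The Laplace transform at \<open>\<theta>\<close> of the exponential waiting time.
\<close>

definition discount_factor :: real where
  "discount_factor = shock_rate S / (shock_rate S + discount_rate S)"

lemma discount_factor_bounds: "0 < discount_factor" "discount_factor < 1"
  using params_pos by (auto simp: discount_factor_def)

text \<open>
  Bounded and measurable on the domain; such functions have all expectations needed. The
  composition with projections expresses measurability on the domain as measurability on the plane.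
\<close>

definition regular :: "(real \<Rightarrow> real \<Rightarrow> real) \<Rightarrow> bool" where
  "regular J \<longleftrightarrow>
     (\<lambda>p. J (clip (capacity S) (fst p)) (clip (max_shock S) (snd p))) \<in> borel_measurable (borel \<Otimes>\<^sub>M borel) \<and>
     (\<exists>C. \<forall>s\<in>levels. \<forall>w\<in>sizes. \<bar>J s w\<bar> \<le> C)"

lemma regularD:
  assumes "regular J" "f \<in> borel_measurable N" "h \<in> borel_measurable N"
  shows "(\<lambda>p. J (clip (capacity S) (f p)) (clip (max_shock S) (h p))) \<in> borel_measurable N"
proof -
  note [measurable] = assms(2,3)
  have "(\<lambda>p. (f p, h p)) \<in> N \<rightarrow>\<^sub>M borel \<Otimes>\<^sub>M borel" by measurable
  moreover have "(\<lambda>p. J (clip (capacity S) (fst p)) (clip (max_shock S) (snd p))) \<in> borel_measurable (borel \<Otimes>\<^sub>M borel)"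
    using assms(1) by (simp add: regular_def)
  ultimately have "(\<lambda>p. J (clip (capacity S) (fst (f p, h p))) (clip (max_shock S) (snd (f p, h p)))) \<in> borel_measurable N"
    by (rule measurable_compose)
  then show ?thesis by simp
qed

lemma regular_diff:
  assumes "regular J" "regular J'"
  shows "regular (\<lambda>s w. J s w - J' s w)"
  unfolding regular_def
proof
  show "(\<lambda>p. J (clip (capacity S) (fst p)) (clip (max_shock S) (snd p)) -
      J' (clip (capacity S) (fst p)) (clip (max_shock S) (snd p))) \<in> borel_measurable (borel \<Otimes>\<^sub>M borel)"
    using assms unfolding regular_def by (intro borel_measurable_diff) blast+
  obtain C C' where "\<forall>s\<in>levels. \<forall>w\<in>sizes. \<bar>J s w\<bar> \<le> C" "\<forall>s\<in>levels. \<forall>w\<in>sizes. \<bar>J' s w\<bar> \<le> C'"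
    using assms unfolding regular_def by blast
  then show "\<exists>C. \<forall>s\<in>levels. \<forall>w\<in>sizes. \<bar>J s w - J' s w\<bar> \<le> C"
    by (intro exI[of _ "C + C'"] ballI order_trans[OF abs_triangle_ineq4] add_mono) blast+
qed

lemma regular_const: "regular (\<lambda>_ _. k)"
  unfolding regular_def by auto

lemma continuation_integrand_clip:
  assumes "x \<in> levels"
  shows "continuation_integrand J x = continuation_integrand (\<lambda>s w. J (clip (capacity S) s) (clip (max_shock S) w)) x"
  by (rule ext, rule continuation_integrand_cong) (use assms in simp_all)

lemma measurable_continuation_integrand:
  assumes "regular J" "x \<in> levels"
  shows "continuation_integrand J x \<in> borel_measurable law"
proof -
  have [measurable]: "(\<lambda>p. J (clip (capacity S) (refill S x (fst p))) (clip (max_shock S) (snd p))) \<in> borel_measurable law"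
    by (rule regularD[OF assms(1)]) measurable
  show ?thesis
    by (subst continuation_integrand_clip[OF assms(2)]) (unfold continuation_integrand_def, measurable)
qed

lemma continuation_integrand_bound:
  assumes "x \<in> levels" "\<And>s w. s \<in> levels \<Longrightarrow> w \<in> sizes \<Longrightarrow> \<bar>J s w\<bar> \<le> C"
  shows "\<bar>continuation_integrand J x p\<bar> \<le> C * continuation_integrand (\<lambda>_ _. 1) x p"
proof (cases "p \<in> {0..} \<times> sizes")
  case True
  then have "\<bar>J (refill S x (fst p)) (snd p)\<bar> \<le> C"
    by (intro assms(2) refill_in assms(1)) auto
  then show ?thesis
    using True by (simp add: continuation_integrand_def abs_mult)
qed (simp add: continuation_integrand_def)

lemma continuation_integrand_one_bounds: "0 \<le> continuation_integrand (\<lambda>_ _. 1) x p" "continuation_integrand (\<lambda>_ _. 1) x p \<le> 1"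
  using params_pos by (auto simp: continuation_integrand_def indicator_def)

lemma regular_imp_continuation_exists:
  assumes "regular J"
  shows "continuation_exists S J"
  unfolding continuation_exists_eq
proof
  fix x assume x: "x \<in> levels"
  obtain C where C: "\<And>s w. s \<in> levels \<Longrightarrow> w \<in> sizes \<Longrightarrow> \<bar>J s w\<bar> \<le> C"
    using assms unfolding regular_def by blast
  have "0 \<le> C" using C[OF zero_in(1,3)] by linarith
  have "\<bar>continuation_integrand J x p\<bar> \<le> C * continuation_integrand (\<lambda>_ _. 1) x p" for p
    by (rule continuation_integrand_bound) (use x C in blast)+
  then have "\<bar>continuation_integrand J x p\<bar> \<le> C" for p
    using mult_left_mono[OF continuation_integrand_one_bounds(2) \<open>0 \<le> C\<close>]
    by (metis mult.right_neutral order_trans)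
  then show "integrable law (continuation_integrand J x)"
    by (intro both.integrable_const_bound[where B=C] measurable_continuation_integrand assms x) auto
qed

lemma mean_over_size_one: "mean_over_size (\<lambda>_ _. 1) y = 1"
proof -
  have "mean_over_size (\<lambda>_ _. 1) y = measure (size_law S) sizes"
    unfolding mean_over_size_def by simp
  also have "\<dots> = 1"
    using AE_size by (subst size.prob_eq_1) auto
  finally show ?thesis .
qed

lemma expected_continuation_one:
  assumes x: "x \<in> levels"
  shows "expected_continuation S (\<lambda>_ _. 1) x = discount_factor"
proof -
  let ?a = "shock_rate S + discount_rate S"
  have "gap_integrand (\<lambda>_ _. 1) x t = discount_factor * exponential_density ?a t" for t
  proof -
    have "exp (- t * ?a) = exp (- t * shock_rate S) * exp (- discount_rate S * t)"
      by (simp add: exp_add[symmetric] algebra_simps)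
    then show ?thesis
      unfolding gap_integrand_def mean_over_size_one discount_factor_def exponential_density_def
      using params_pos by auto
  qed
  moreover have "integrable law (continuation_integrand (\<lambda>_ _. 1) x)"
    using regular_imp_continuation_exists[OF regular_const] x by (simp add: continuation_exists_eq)
  ultimately have "expected_continuation S (\<lambda>_ _. 1) x = discount_factor * (\<integral>t. exponential_density ?a t \<partial>lborel)"
    using expected_continuation_iterated(2)[of "\<lambda>_ _. 1" x] by (simp cong: Bochner_Integration.integral_cong)
  also have "(\<integral>t. exponential_density ?a t \<partial>lborel) = 1"
  proof -
    interpret E: prob_space "density lborel (exponential_density ?a)"
      by (rule prob_space_exponential_density) (use params_pos in auto)
    have "(\<integral>t. exponential_density ?a t \<partial>lborel) = (\<integral>t. 1 \<partial>density lborel (exponential_density ?a))"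
      using params_pos by (subst integral_density) (auto simp: exponential_density_nonneg)
    also have "\<dots> = 1"
      using E.prob_space by simp
    finally show ?thesis .
  qed
  finally show ?thesis by simp
qed

text \<open>
  The contraction property: the expected discount until the next shock is \<open>Q / (Q + \<theta>)\<close>.
\<close>

lemma expected_continuation_diff:
  assumes "continuation_exists S J" "continuation_exists S J'" "x \<in> levels"
    and "\<And>s w. s \<in> levels \<Longrightarrow> w \<in> sizes \<Longrightarrow> \<bar>J s w - J' s w\<bar> \<le> e"
  shows "\<bar>expected_continuation S J x - expected_continuation S J' x\<bar> \<le> discount_factor * e"
proof -
  have i: "integrable law (continuation_integrand J x)" "integrable law (continuation_integrand J' x)"
    "integrable law (continuation_integrand (\<lambda>_ _. 1) x)"
    using assms(1-3) regular_imp_continuation_exists[OF regular_const] by (auto simp: continuation_exists_eq)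
  have "expected_continuation S J x - expected_continuation S J' x =
      (\<integral>p. continuation_integrand J x p - continuation_integrand J' x p \<partial>law)"
    unfolding expected_continuation_eq using i by simp
  also have "\<bar>\<dots>\<bar> \<le> (\<integral>p. \<bar>continuation_integrand J x p - continuation_integrand J' x p\<bar> \<partial>law)"
    by (rule integral_abs_bound)
  also have "\<dots> \<le> (\<integral>p. e * continuation_integrand (\<lambda>_ _. 1) x p \<partial>law)"
  proof (rule integral_mono)
    fix p
    have "continuation_integrand J x p - continuation_integrand J' x p = continuation_integrand (\<lambda>s w. J s w - J' s w) x p"
      by (simp add: continuation_integrand_def algebra_simps)
    then show "\<bar>continuation_integrand J x p - continuation_integrand J' x p\<bar> \<le> e * continuation_integrand (\<lambda>_ _. 1) x p"
      using continuation_integrand_bound[of x "\<lambda>s w. J s w - J' s w" e p] assms(3,4) by simp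
  qed (use i in auto)
  also have "\<dots> = discount_factor * e"
    using expected_continuation_one[OF assms(3)] by (simp add: expected_continuation_eq)
  finally show ?thesis .
qed

section \<open>The Bellman operator\<close>

lemma continuous_clip_compose:
  assumes "continuous_on {0..b} f" "0 < b"
  shows "continuous_on A (\<lambda>x. f (clip b x))"
  by (rule continuous_on_compose2[OF assms(1)])
    (use assms(2) clip_in[of b] in \<open>auto intro!: continuous_intros simp del: atLeastAtMost_iff\<close>)

lemma stage_cost_clip: "continuous_on A (\<lambda>x. stage_cost S (clip (max_shock S) x))"
  by (rule continuous_clip_compose[OF stage_cost_cont]) (rule params_pos)

lemma measurable_stage_cost_clip [measurable]:
  "(\<lambda>x. stage_cost S (clip (max_shock S) x)) \<in> borel_measurable borel"
  by (rule borel_measurable_continuous_onI[OF stage_cost_clip])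

lemma policy_bounds:
  assumes "\<mu> \<in> policies S" "s \<in> levels" "w \<in> sizes"
  shows "\<mu> s w \<in> {0..min s w}" "s - \<mu> s w \<in> levels" "w - \<mu> s w \<in> sizes"
  using assms unfolding policies_def by fastforce+

lemma policy_regular:
  assumes "\<mu> \<in> policies S"
  shows "regular \<mu>"
  unfolding regular_def
proof
  let ?R = "restrict_space borel (levels \<times> sizes) :: (real \<times> real) measure"
  have m: "(\<lambda>(s, w). \<mu> s w) \<in> borel_measurable ?R"
    using assms by (simp add: policies_def)
  have "(\<lambda>p. (clip (capacity S) (fst p), clip (max_shock S) (snd p))) \<in> borel \<Otimes>\<^sub>M borel \<rightarrow>\<^sub>M ?R"
    by (rule measurable_restrict_space2) (use clip_in_domain in \<open>auto simp: borel_prod[symmetric]\<close>)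
  from measurable_compose[OF this m]
  show "(\<lambda>p. \<mu> (clip (capacity S) (fst p)) (clip (max_shock S) (snd p))) \<in> borel_measurable (borel \<Otimes>\<^sub>M borel)"
    by simp
  show "\<exists>C. \<forall>s\<in>levels. \<forall>w\<in>sizes. \<bar>\<mu> s w\<bar> \<le> C"
    using policy_bounds(1)[OF assms] by (intro exI[of _ "capacity S"]) fastforce
qed

definition greedy_for :: "(real \<Rightarrow> real) \<Rightarrow> (real \<Rightarrow> real \<Rightarrow> real) \<Rightarrow> bool" where
  "greedy_for v \<mu> \<longleftrightarrow> (\<forall>s\<in>levels. \<forall>w\<in>sizes. \<forall>u\<in>{0..min s w}.
     stage_cost S (w - \<mu> s w) + v (s - \<mu> s w) \<le> stage_cost S (w - u) + v (s - u))"

text \<open>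
  Actions are parametrised by fractions \<open>l \<in> [0, 1]\<close> of the largest admissible one, \<open>min s w\<close>, which
  turns the state-dependent constraint interval into a fixed compact one.
\<close>

lemma greedy_policy_exists:
  assumes v: "continuous_on levels v"
  shows "\<exists>\<mu>\<in>policies S. greedy_for v \<mu>"
proof -
  let ?s = "\<lambda>p::real \<times> real. clip (capacity S) (fst p)" and ?w = "\<lambda>p::real \<times> real. clip (max_shock S) (snd p)"
  let ?B = "borel \<Otimes>\<^sub>M borel :: (real \<times> real) measure"
  let ?u = "\<lambda>p l. l * min (?s p) (?w p)"
  define G where "G p l = stage_cost S (clip (max_shock S) (?w p - ?u p l)) +
      v (clip (capacity S) (?s p - ?u p l))" for p l
  have vc: "continuous_on A (\<lambda>x. v (clip (capacity S) x))" for A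
    by (rule continuous_clip_compose[OF v]) (rule params_pos)
  have [measurable]: "(\<lambda>x. v (clip (capacity S) x)) \<in> borel_measurable borel"
    by (rule borel_measurable_continuous_onI[OF vc])
  obtain L where L [measurable]: "L \<in> borel_measurable ?B"
    and L01: "\<And>p. L p \<in> {0..1}"
    and Lmin: "\<And>p l. l \<in> {0..1} \<Longrightarrow> G p (L p) \<le> G p l"
  proof (rule measurable_compact_selection[of G ?B])
    show "(\<lambda>p. G p l) \<in> borel_measurable ?B" for l
      unfolding G_def by measurable
    show "continuous_on {0..1} (G p)" for p
      unfolding G_def
      by (intro continuous_intros continuous_on_compose2[OF stage_cost_clip[of UNIV]]
          continuous_on_compose2[OF vc[of UNIV]]) auto
  qed (auto simp: space_pair_measure)
  define \<mu> where "\<mu> s w = ?u (s, w) (L (s, w))" for s w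
  have bounds: "\<mu> s w \<in> {0..min s w}" if "s \<in> levels" "w \<in> sizes" for s w
    using that L01[of "(s, w)"] unfolding \<mu>_def by (auto simp: mult_left_le mult_left_le_one_le min_def)
  have G_eq: "G (s, w) l = stage_cost S (w - l * min s w) + v (s - l * min s w)"
    if "s \<in> levels" "w \<in> sizes" "l \<in> {0..1}" for s w l
  proof -
    have "0 \<le> l * min s w" "l * min s w \<le> min s w"
      using that by (auto intro: mult_left_le_one_le simp del: min.bounded_iff)
    then show ?thesis
      using that unfolding G_def by (simp add: clip_id)
  qed
  have "(\<lambda>(s, w). \<mu> s w) \<in> borel_measurable borel"
    unfolding \<mu>_def borel_prod[symmetric] by measurable
  then have "\<mu> \<in> policies S"
    unfolding policies_def using bounds by (auto intro: measurable_restrict_space1)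
  moreover have "greedy_for v \<mu>"
    unfolding greedy_for_def
  proof (intro ballI)
    fix s w u assume sw: "s \<in> levels" "w \<in> sizes" and u: "u \<in> {0..min s w}"
    obtain l where l: "l \<in> {0..1}" "u = l * min s w"
    proof (cases "min s w = 0")
      case True
      then show ?thesis using that[of 0] u by auto
    next
      case False
      then have "0 < min s w" using u by auto
      moreover have "u \<le> min s w" "0 \<le> u" using u by auto
      ultimately have "u / min s w \<in> {0..1}" by simp
      then show ?thesis using that False by (metis nonzero_divide_eq_eq)
    qed
    show "stage_cost S (w - \<mu> s w) + v (s - \<mu> s w) \<le> stage_cost S (w - u) + v (s - u)"
      using Lmin[OF l(1), of "(s, w)"] sw unfolding G_eq[OF sw L01] G_eq[OF sw l(1)] l(2) \<mu>_def by simp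
  qed
  ultimately show ?thesis by blast
qed

text \<open>
  The Bellman operator as a function of the cost \<open>v\<close> of the level left after the action. Continuity
  of \<open>v\<close>, which expected continuations have, is what makes the minimum attained.
\<close>

definition optimal_value :: "(real \<Rightarrow> real) \<Rightarrow> real \<Rightarrow> real \<Rightarrow> real" where
  "optimal_value v s w = minimum (\<lambda>u. stage_cost S (w - u) + v (s - u)) {0..min s w}"

lemma bellman_eq: "bellman S J = optimal_value (expected_continuation S J)"
  by (rule ext)+ (simp add: bellman_def optimal_value_def action_cost_def[abs_def])

lemma optimal_value_greedy:
  assumes "\<mu> \<in> policies S" "greedy_for v \<mu>" "s \<in> levels" "w \<in> sizes"
  shows "optimal_value v s w = stage_cost S (w - \<mu> s w) + v (s - \<mu> s w)"
  unfolding optimal_value_def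
  by (rule minimum_eqI) (use assms policy_bounds(1)[OF assms(1,3,4)] in \<open>auto simp: greedy_for_def\<close>)

lemma optimal_value_le:
  assumes "continuous_on levels v" "s \<in> levels" "w \<in> sizes" "u \<in> {0..min s w}"
  shows "optimal_value v s w \<le> stage_cost S (w - u) + v (s - u)"
proof -
  obtain \<mu> where "\<mu> \<in> policies S" "greedy_for v \<mu>"
    using greedy_policy_exists[OF assms(1)] by blast
  then show ?thesis
    using assms by (simp add: optimal_value_greedy greedy_for_def del: atLeastAtMost_iff)
qed

lemma bounded_stage_cost: "\<exists>C. \<forall>w\<in>sizes. \<bar>stage_cost S w\<bar> \<le> C"
  using model unfolding storage_model_def bounded_iff by auto

lemma bounded_value: "continuous_on levels v \<Longrightarrow> \<exists>C. \<forall>x\<in>levels. \<bar>v x\<bar> \<le> C" for v :: "real \<Rightarrow> real"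
  using compact_imp_bounded[OF compact_continuous_image[of levels v]] unfolding bounded_iff by auto

lemma action_regular:
  assumes v: "continuous_on levels v" and \<mu>: "\<mu> \<in> policies S"
  shows "regular (\<lambda>s w. stage_cost S (w - \<mu> s w) + v (s - \<mu> s w))"
  unfolding regular_def
proof
  let ?s = "\<lambda>p::real \<times> real. clip (capacity S) (fst p)" and ?w = "\<lambda>p::real \<times> real. clip (max_shock S) (snd p)"
  let ?B = "borel \<Otimes>\<^sub>M borel :: (real \<times> real) measure"
  have vc: "continuous_on A (\<lambda>x. v (clip (capacity S) x))" for A
    by (rule continuous_clip_compose[OF v]) (rule params_pos)
  have [measurable]: "(\<lambda>x. v (clip (capacity S) x)) \<in> borel_measurable borel"
    by (rule borel_measurable_continuous_onI[OF vc])
  have [measurable]: "(\<lambda>p. \<mu> (?s p) (?w p)) \<in> borel_measurable ?B"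
    using policy_regular[OF \<mu>] by (simp add: regular_def)
  have "(\<lambda>p. stage_cost S (clip (max_shock S) (?w p - \<mu> (?s p) (?w p))) +
      v (clip (capacity S) (?s p - \<mu> (?s p) (?w p)))) \<in> borel_measurable ?B"
    by measurable
  then show "(\<lambda>p. stage_cost S (?w p - \<mu> (?s p) (?w p)) + v (?s p - \<mu> (?s p) (?w p))) \<in> borel_measurable ?B"
    using policy_bounds(2,3)[OF \<mu> clip_in_domain] by (simp del: atLeastAtMost_iff)
  obtain C1 where "\<forall>w\<in>sizes. \<bar>stage_cost S w\<bar> \<le> C1" using bounded_stage_cost by blast
  moreover obtain C2 where "\<forall>x\<in>levels. \<bar>v x\<bar> \<le> C2" using bounded_value[OF v] by blast
  ultimately show "\<exists>C. \<forall>s\<in>levels. \<forall>w\<in>sizes. \<bar>stage_cost S (w - \<mu> s w) + v (s - \<mu> s w)\<bar> \<le> C"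
    using policy_bounds(2,3)[OF \<mu>]
    by (intro exI[of _ "C1 + C2"] ballI order_trans[OF abs_triangle_ineq] add_mono) blast+
qed

lemma regular_cong:
  assumes "regular J" "\<And>s w. s \<in> levels \<Longrightarrow> w \<in> sizes \<Longrightarrow> J' s w = J s w"
  shows "regular J'"
  using assms clip_in_domain unfolding regular_def by (auto simp del: atLeastAtMost_iff)

lemma optimal_value_regular:
  assumes "continuous_on levels v"
  shows "regular (optimal_value v)"
proof -
  obtain \<mu> where "\<mu> \<in> policies S" "greedy_for v \<mu>"
    using greedy_policy_exists[OF assms] by blast
  then show ?thesis
    using regular_cong[OF action_regular[OF assms]] optimal_value_greedy by blast
qed

lemma optimal_value_diff:
  assumes "continuous_on levels v" "continuous_on levels v'"
    and e: "\<And>x. x \<in> levels \<Longrightarrow> \<bar>v x - v' x\<bar> \<le> e"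
    and sw: "s \<in> levels" "w \<in> sizes"
  shows "\<bar>optimal_value v s w - optimal_value v' s w\<bar> \<le> e"
proof -
  have one_side: "optimal_value v s w \<le> optimal_value v' s w + e"
    if v: "continuous_on levels v" "continuous_on levels v'" and e: "\<And>x. x \<in> levels \<Longrightarrow> \<bar>v x - v' x\<bar> \<le> e"
    for v v' :: "real \<Rightarrow> real"
  proof -
    obtain \<mu> where \<mu>: "\<mu> \<in> policies S" "greedy_for v' \<mu>"
      using greedy_policy_exists[OF v(2)] by blast
    have "optimal_value v s w \<le> stage_cost S (w - \<mu> s w) + v (s - \<mu> s w)"
      by (rule optimal_value_le[OF v(1) sw policy_bounds(1)[OF \<mu>(1) sw]])
    also have "\<dots> \<le> stage_cost S (w - \<mu> s w) + v' (s - \<mu> s w) + e"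
      using e[OF policy_bounds(2)[OF \<mu>(1) sw]] by simp
    finally show ?thesis
      by (simp add: optimal_value_greedy[OF \<mu> sw])
  qed
  have "optimal_value v s w \<le> optimal_value v' s w + e"
    by (rule one_side) (use assms in auto)
  moreover have "optimal_value v' s w \<le> optimal_value v s w + e"
    by (rule one_side) (use assms in \<open>auto simp: abs_minus_commute\<close>)
  ultimately show ?thesis by linarith
qed

lemma optimal_value_cong:
  assumes "\<And>x. x \<in> levels \<Longrightarrow> v x = v' x" "s \<in> levels" "w \<in> sizes"
  shows "optimal_value v s w = optimal_value v' s w"
proof -
  have "(\<lambda>u. stage_cost S (w - u) + v (s - u)) ` {0..min s w} =
      (\<lambda>u. stage_cost S (w - u) + v' (s - u)) ` {0..min s w}"
    by (rule image_cong) (use assms in auto)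
  then show ?thesis
    unfolding optimal_value_def minimum_def by simp
qed

lemma bellman_cong:
  assumes "\<And>s w. s \<in> levels \<Longrightarrow> w \<in> sizes \<Longrightarrow> J s w = J' s w" "s \<in> levels" "w \<in> sizes"
  shows "bellman S J s w = bellman S J' s w"
  unfolding bellman_eq
  by (rule optimal_value_cong, rule expected_continuation_cong) (use assms in auto)

lemma bellman_regular: "continuation_exists S J \<Longrightarrow> regular (bellman S J)"
  unfolding bellman_eq by (intro optimal_value_regular continuous_expected_continuation)

lemma bellman_contraction:
  assumes "continuation_exists S J" "continuation_exists S J'"
    and "\<And>s w. s \<in> levels \<Longrightarrow> w \<in> sizes \<Longrightarrow> \<bar>J s w - J' s w\<bar> \<le> e"
    and "s \<in> levels" "w \<in> sizes"
  shows "\<bar>bellman S J s w - bellman S J' s w\<bar> \<le> discount_factor * e"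
  unfolding bellman_eq
  by (rule optimal_value_diff) (use assms in \<open>auto intro!: continuous_expected_continuation expected_continuation_diff simp del: atLeastAtMost_iff\<close>)

text \<open>
  The starting points may be unbounded and infinitely far apart, but their images under one Bellman
  step are bounded; the geometric decay starts from there.
\<close>

lemma bellman_iterates_diff:
  assumes "continuation_exists S J" "continuation_exists S J'"
  shows "\<exists>C. \<forall>n. \<forall>s\<in>levels. \<forall>w\<in>sizes.
    \<bar>(bellman S ^^ Suc n) J s w - (bellman S ^^ Suc n) J' s w\<bar> \<le> C * discount_factor ^ n"
proof -
  have ex: "continuation_exists S ((bellman S ^^ n) J)" if "continuation_exists S J" for J n
    by (induction n) (use that in \<open>auto intro: regular_imp_continuation_exists bellman_regular\<close>)
  obtain C1 C2 where C: "\<forall>s\<in>levels. \<forall>w\<in>sizes. \<bar>bellman S J s w\<bar> \<le> C1"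
      "\<forall>s\<in>levels. \<forall>w\<in>sizes. \<bar>bellman S J' s w\<bar> \<le> C2"
    using bellman_regular[OF assms(1)] bellman_regular[OF assms(2)] unfolding regular_def by blast
  have "\<bar>(bellman S ^^ Suc n) J s w - (bellman S ^^ Suc n) J' s w\<bar> \<le> (C1 + C2) * discount_factor ^ n"
    if "s \<in> levels" "w \<in> sizes" for n s w
    using that
  proof (induction n arbitrary: s w)
    case 0
    have "\<bar>bellman S J s w\<bar> \<le> C1" "\<bar>bellman S J' s w\<bar> \<le> C2" using C 0 by blast+
    then show ?case by simp
  next
    case (Suc n)
    show ?case
      using bellman_contraction[OF ex[OF assms(1), of "Suc n"] ex[OF assms(2), of "Suc n"] Suc.IH Suc.prems]
      by (simp add: mult_ac)
  qed
  then show ?thesis by blast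
qed

lemma bellman_iterate_fixed:
  assumes "\<And>s w. s \<in> levels \<Longrightarrow> w \<in> sizes \<Longrightarrow> bellman S J s w = J s w" "s \<in> levels" "w \<in> sizes"
  shows "(bellman S ^^ n) J s w = J s w"
  using assms(2,3)
proof (induction n arbitrary: s w)
  case (Suc n)
  have "bellman S ((bellman S ^^ n) J) s w = bellman S J s w"
    by (intro bellman_cong Suc)
  then show ?case using assms(1) Suc.prems by simp
qed simp

lemma value_iteration_converges:
  assumes "continuation_exists S J" "continuation_exists S J0"
    and "\<And>s w. s \<in> levels \<Longrightarrow> w \<in> sizes \<Longrightarrow> bellman S J s w = J s w"
  shows "uniform_limit (levels \<times> sizes) (\<lambda>k (s, w). (bellman S ^^ k) J0 s w) (\<lambda>(s, w). J s w) sequentially"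
proof -
  obtain C where C: "\<And>n s w. s \<in> levels \<Longrightarrow> w \<in> sizes \<Longrightarrow>
      \<bar>(bellman S ^^ Suc n) J0 s w - (bellman S ^^ Suc n) J s w\<bar> \<le> C * discount_factor ^ n"
    using bellman_iterates_diff[OF assms(2,1)] by blast
  have "(\<lambda>n. C * discount_factor ^ n) \<longlonglongrightarrow> 0"
    using discount_factor_bounds by (intro tendsto_mult_right_zero LIMSEQ_realpow_zero) auto
  show ?thesis
  proof (rule uniform_limitI)
    fix e :: real assume "0 < e"
    with \<open>(\<lambda>n. C * discount_factor ^ n) \<longlonglongrightarrow> 0\<close>
    have "\<forall>\<^sub>F n in sequentially. C * discount_factor ^ n < e"
      by (rule order_tendstoD)
    then have "\<forall>\<^sub>F n in sequentially. \<forall>p\<in>levels \<times> sizes.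
        dist (case p of (s, w) \<Rightarrow> (bellman S ^^ Suc n) J0 s w) (case p of (s, w) \<Rightarrow> J s w) < e"
    proof eventually_elim
      case (elim n)
      have "\<bar>(bellman S ^^ Suc n) J0 s w - J s w\<bar> < e" if "s \<in> levels" "w \<in> sizes" for s w
        using C[OF that, of n] elim bellman_iterate_fixed[OF assms(3) that, of "Suc n"] by linarith
      then show ?case by (auto simp: dist_real_def simp del: atLeastAtMost_iff)
    qed
    then show "\<forall>\<^sub>F n in sequentially. \<forall>p\<in>levels \<times> sizes.
        dist (case p of (s, w) \<Rightarrow> (bellman S ^^ n) J0 s w) (case p of (s, w) \<Rightarrow> J s w) < e"
      by (subst (asm) eventually_sequentially_Suc)
  qed
qed

lemma bellman_fixed_point_unique:
  assumes "continuation_exists S J" "continuation_exists S J'"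
    and "\<And>s w. s \<in> levels \<Longrightarrow> w \<in> sizes \<Longrightarrow> bellman S J s w = J s w"
    and "\<And>s w. s \<in> levels \<Longrightarrow> w \<in> sizes \<Longrightarrow> bellman S J' s w = J' s w"
    and sw: "s \<in> levels" "w \<in> sizes"
  shows "J s w = J' s w"
proof -
  have "(\<lambda>k. (bellman S ^^ k) J s w) \<longlonglongrightarrow> J' s w"
    using tendsto_uniform_limitI[OF value_iteration_converges[OF assms(2,1,4)], of "(s, w)"] sw by simp
  moreover have "(bellman S ^^ k) J s w = J s w" for k
    by (rule bellman_iterate_fixed) (use assms(3) sw in blast)+
  ultimately show ?thesis
    by (simp add: LIMSEQ_const_iff)
qed

text \<open>
  Banach's theorem is applied to the cost of the level after an action rather than to the cost
  of a shock, as the former lives in the complete space of bounded continuous functions on the line.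
\<close>

lemma bellman_fixed_point_exists:
  obtains J where "regular J" "\<And>s w. s \<in> levels \<Longrightarrow> w \<in> sizes \<Longrightarrow> bellman S J s w = J s w"
proof -
  define A :: "real \<Rightarrow>\<^sub>C real \<Rightarrow> real \<Rightarrow>\<^sub>C real" where
    "A f = Bcontfun (\<lambda>x. expected_continuation S (optimal_value (apply_bcontfun f)) (clip (capacity S) x))" for f
  have ex: "continuation_exists S (optimal_value (apply_bcontfun f))" for f
    by (intro regular_imp_continuation_exists optimal_value_regular) simp
  have A: "apply_bcontfun (A f) x = expected_continuation S (optimal_value (apply_bcontfun f)) (clip (capacity S) x)" for f x
  proof -
    let ?v = "expected_continuation S (optimal_value (apply_bcontfun f))"
    have c: "continuous_on levels ?v" by (rule continuous_expected_continuation[OF ex])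
    obtain C where "\<forall>x\<in>levels. \<bar>?v x\<bar> \<le> C" using bounded_value[OF c] by blast
    then have "(\<lambda>x. ?v (clip (capacity S) x)) \<in> bcontfun"
      using clip_in_domain(1) by (intro bcontfun_normI[of _ C] continuous_clip_compose c params_pos) auto
    then show ?thesis unfolding A_def by (simp add: Bcontfun_inverse)
  qed
  have "\<exists>!f\<in>UNIV. A f = f"
  proof (rule Banach_fix[where c=discount_factor])
    fix f h :: "real \<Rightarrow>\<^sub>C real"
    show "dist (A f) (A h) \<le> discount_factor * dist f h"
    proof (rule dist_bound)
      fix x
      have "\<bar>optimal_value (apply_bcontfun f) s w - optimal_value (apply_bcontfun h) s w\<bar> \<le> dist f h"
        if "s \<in> levels" "w \<in> sizes" for s w
        using that dist_bounded[of f _ h] by (intro optimal_value_diff) (auto simp: dist_real_def)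
      then show "dist (apply_bcontfun (A f) x) (apply_bcontfun (A h) x) \<le> discount_factor * dist f h"
        unfolding A dist_real_def by (intro expected_continuation_diff ex clip_in_domain)
    qed
  qed (use discount_factor_bounds in \<open>auto simp: complete_UNIV\<close>)
  then obtain f where f: "A f = f" by blast
  let ?J = "optimal_value (apply_bcontfun f)"
  have "bellman S ?J s w = ?J s w" if "s \<in> levels" "w \<in> sizes" for s w
    unfolding bellman_eq
  proof (rule optimal_value_cong[OF _ that])
    fix x assume "x \<in> levels"
    then show "expected_continuation S ?J x = apply_bcontfun f x"
      using A[of f x] f by simp
  qed
  then show ?thesis
    by (intro that[of ?J] optimal_value_regular) auto
qed

end

section \<open>The controlled process\<close>

lemma (in prob_space) indep_var_expectation_iterated:
  fixes h :: "'b \<times> 'b \<Rightarrow> real"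
  assumes ind: "indep_var N1 U N2 Z" and [measurable]: "h \<in> borel_measurable (N1 \<Otimes>\<^sub>M N2)"
    and int: "integrable M (\<lambda>\<omega>. h (U \<omega>, Z \<omega>))"
  shows "expectation (\<lambda>\<omega>. h (U \<omega>, Z \<omega>)) = expectation (\<lambda>\<omega>. \<integral>z. h (U \<omega>, z) \<partial>distr M N2 Z)"
proof -
  have [measurable]: "U \<in> M \<rightarrow>\<^sub>M N1" "Z \<in> M \<rightarrow>\<^sub>M N2"
    and joint: "distr M (N1 \<Otimes>\<^sub>M N2) (\<lambda>\<omega>. (U \<omega>, Z \<omega>)) = distr M N1 U \<Otimes>\<^sub>M distr M N2 Z"
    using ind by (simp_all add: indep_var_distribution_eq)
  interpret U: prob_space "distr M N1 U" by (rule prob_space_distr) simp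
  interpret Z: prob_space "distr M N2 Z" by (rule prob_space_distr) simp
  interpret UZ: pair_prob_space "distr M N1 U" "distr M N2 Z" ..
  have "integrable (distr M (N1 \<Otimes>\<^sub>M N2) (\<lambda>\<omega>. (U \<omega>, Z \<omega>))) h"
    using int by (subst integrable_distr_eq) auto
  then have i: "integrable (distr M N1 U \<Otimes>\<^sub>M distr M N2 Z) h"
    by (simp only: joint)
  have "expectation (\<lambda>\<omega>. h (U \<omega>, Z \<omega>)) = (\<integral>p. h p \<partial>distr M (N1 \<Otimes>\<^sub>M N2) (\<lambda>\<omega>. (U \<omega>, Z \<omega>)))"
    by (subst integral_distr) auto
  also have "\<dots> = (\<integral>u. \<integral>z. h (u, z) \<partial>distr M N2 Z \<partial>distr M N1 U)"
    unfolding joint by (rule UZ.integral_fst'[OF i, symmetric])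
  also have "\<dots> = expectation (\<lambda>\<omega>. \<integral>z. h (U \<omega>, z) \<partial>distr M N2 Z)"
  proof (rule integral_distr)
    have "sets (N1 \<Otimes>\<^sub>M distr M N2 Z) = sets (N1 \<Otimes>\<^sub>M N2)"
      by (rule sets_pair_measure_cong) simp_all
    from measurable_cong_sets[OF this refl]
    have "(\<lambda>(u, z). h (u, z)) \<in> borel_measurable (N1 \<Otimes>\<^sub>M distr M N2 Z)"
      using assms(2) by simp
    then show "(\<lambda>u. \<integral>z. h (u, z) \<partial>distr M N2 Z) \<in> borel_measurable N1"
      by (rule Z.borel_measurable_lebesgue_integral)
  qed simp
  finally show ?thesis .
qed

lemma AE_summable_of_expectations:
  fixes f :: "nat \<Rightarrow> 'b \<Rightarrow> real"
  assumes int: "\<And>n. integrable M (f n)" and nn: "\<And>n x. x \<in> space M \<Longrightarrow> 0 \<le> f n x"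
    and sum: "summable (\<lambda>n. \<integral>x. f n x \<partial>M)"
  shows "AE x in M. summable (\<lambda>n. f n x)"
proof -
  have [measurable]: "f n \<in> borel_measurable M" for n using int by auto
  have "(\<integral>\<^sup>+x. (\<Sum>n. ennreal (f n x)) \<partial>M) = (\<Sum>n. \<integral>\<^sup>+x. ennreal (f n x) \<partial>M)"
    by (rule nn_integral_suminf) measurable
  also have "\<dots> = (\<Sum>n. ennreal (\<integral>x. f n x \<partial>M))"
    using nn by (simp add: nn_integral_eq_integral[OF int])
  also have "\<dots> \<noteq> \<infinity>"
  proof -
    have "0 \<le> (\<integral>x. f n x \<partial>M)" for n
      using nn by (intro integral_nonneg_AE AE_I2)
    then show ?thesis
      unfolding infinity_ennreal_def by (rule ennreal_suminf_neq_top[OF sum])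
  qed
  finally have "AE x in M. (\<Sum>n. ennreal (f n x)) \<noteq> \<infinity>"
    by (intro nn_integral_PInf_AE) auto
  with AE_space show ?thesis
    by eventually_elim (auto intro: summable_suminf_not_top nn)
qed

locale storage_process = storage +
  fixes M :: "'a measure" and \<tau> W :: "nat \<Rightarrow> 'a \<Rightarrow> real"
  assumes shocks: "shock_process S M \<tau> W"
begin

sublocale P: prob_space M
  using shocks by (simp add: shock_process_def)

lemma gap_pos: "\<omega> \<in> space M \<Longrightarrow> 0 < \<tau> k \<omega>" and size_in: "\<omega> \<in> space M \<Longrightarrow> W k \<omega> \<in> sizes"
  using shocks by (auto simp: shock_process_def)

lemma indep: "P.indep_vars (\<lambda>_. borel) (case_sum \<tau> W) UNIV"
  using shocks by (simp add: shock_process_def)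

lemma measurable_shocks [measurable]: "\<tau> k \<in> borel_measurable M" "W k \<in> borel_measurable M"
proof -
  have "case_sum \<tau> W i \<in> borel_measurable M" for i
    using indep unfolding P.indep_vars_def by blast
  from this[of "Inl k"] this[of "Inr k"]
  show "\<tau> k \<in> borel_measurable M" "W k \<in> borel_measurable M" by simp_all
qed

text \<open>
  The discount at the time of the shock preceding shock \<open>n\<close>, and 1 for the first shock.
\<close>

definition discount :: "nat \<Rightarrow> 'a \<Rightarrow> real" where
  "discount n \<omega> = (\<Prod>j<n. exp (- discount_rate S * \<tau> j \<omega>))"

lemma discount_simps: "discount 0 \<omega> = 1" "discount (Suc n) \<omega> = discount n \<omega> * exp (- discount_rate S * \<tau> n \<omega>)"
  by (simp_all add: discount_def)

lemma exp_arrival_time: "exp (- discount_rate S * arrival_time \<tau> k \<omega>) = discount (Suc k) \<omega>"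
  unfolding discount_def arrival_time_def lessThan_Suc_atMost sum_distrib_left by (rule exp_sum) simp

lemma discount_bounds:
  assumes "\<omega> \<in> space M"
  shows "0 < discount n \<omega>" "discount n \<omega> \<le> 1"
proof -
  show "0 < discount n \<omega>" unfolding discount_def by (rule prod_pos) simp
  show "discount n \<omega> \<le> 1"
    unfolding discount_def using gap_pos[OF assms] params_pos by (intro prod_le_1) (auto intro: less_imp_le)
qed

text \<open>
  The level right after the shock that precedes shock \<open>n\<close>. For admissible policies and initial levels
  the projections change nothing on the sample space, but they make the level a measurable function
  of the past for all values of its arguments.
\<close>

primrec post_level :: "(real \<Rightarrow> real \<Rightarrow> real) \<Rightarrow> real \<Rightarrow> nat \<Rightarrow> 'a \<Rightarrow> real" where
  "post_level \<mu> x 0 \<omega> = x"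
| "post_level \<mu> x (Suc n) \<omega> =
     (let l = clip (capacity S) (refill S (post_level \<mu> x n \<omega>) (\<tau> n \<omega>))
      in l - \<mu> l (clip (max_shock S) (W n \<omega>)))"

definition pre_level :: "(real \<Rightarrow> real \<Rightarrow> real) \<Rightarrow> real \<Rightarrow> nat \<Rightarrow> 'a \<Rightarrow> real" where
  "pre_level \<mu> x n \<omega> = refill S (post_level \<mu> x n \<omega>) (\<tau> n \<omega>)"

definition discounted_mean ::
    "(real \<Rightarrow> real \<Rightarrow> real) \<Rightarrow> real \<Rightarrow> nat \<Rightarrow> (real \<Rightarrow> real \<Rightarrow> real) \<Rightarrow> real" where
  "discounted_mean \<mu> x n \<psi> =
     P.expectation (\<lambda>\<omega>. discount (Suc n) \<omega> * \<psi> (pre_level \<mu> x n \<omega>) (W n \<omega>))"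

context
  fixes \<mu> x
  assumes \<mu>: "\<mu> \<in> policies S" and x: "x \<in> levels"
begin

lemma post_level_in: "post_level \<mu> x n \<omega> \<in> levels"
  using x policy_bounds(2)[OF \<mu> clip_in_domain] by (cases n) (auto simp: Let_def simp del: atLeastAtMost_iff)

lemma pre_level_in: "\<omega> \<in> space M \<Longrightarrow> pre_level \<mu> x n \<omega> \<in> levels"
  unfolding pre_level_def by (intro refill_in post_level_in less_imp_le gap_pos)

lemma post_level_Suc:
  assumes "\<omega> \<in> space M"
  shows "post_level \<mu> x (Suc n) \<omega> = pre_level \<mu> x n \<omega> - \<mu> (pre_level \<mu> x n \<omega>) (W n \<omega>)"
  using pre_level_in[OF assms, of n] size_in[OF assms, of n]
  by (simp add: Let_def pre_level_def[symmetric] del: atLeastAtMost_iff)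

lemma level_before_eq:
  assumes "\<omega> \<in> space M"
  shows "level_before S \<tau> W \<mu> x \<omega> n = pre_level \<mu> x n \<omega>"
proof (induction n)
  case (Suc n)
  then show ?case
    using post_level_Suc[OF assms, of n] by (simp add: pre_level_def del: post_level.simps(2))
qed (simp add: pre_level_def)

text \<open>
  The state after \<open>n\<close> shocks is a measurable function of the first \<open>n\<close> waiting times and sizes. The
  function need not be named; only independence of the next shock is drawn from its existence.
\<close>

lemma past_state:
  fixes n :: nat
  defines "A \<equiv> Inl ` {..<n} \<union> Inr ` {..<n}"
  shows "\<exists>f \<in> (PiM A (\<lambda>_. borel)) \<rightarrow>\<^sub>M borel \<Otimes>\<^sub>M borel.
    (\<lambda>\<omega>. (discount n \<omega>, post_level \<mu> x n \<omega>)) = (\<lambda>\<omega>. f (restrict (\<lambda>i. case_sum \<tau> W i \<omega>) A))"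
  unfolding A_def
proof (induction n)
  case 0
  show ?case
    by (rule bexI[of _ "\<lambda>_. (1, x)"]) (auto simp: discount_simps)
next
  case (Suc n)
  \<comment> \<open>index \<open>Inl j\<close> is the waiting time and \<open>Inr j\<close> the size of shock \<open>j\<close>\<close>
  let ?A = "\<lambda>n. Inl ` {..<n} \<union> Inr ` {..<n} :: (nat + nat) set"
  let ?N = "PiM (?A (Suc n)) (\<lambda>_. borel) :: (nat + nat \<Rightarrow> real) measure"
  obtain f where f: "f \<in> (PiM (?A n) (\<lambda>_. borel)) \<rightarrow>\<^sub>M borel \<Otimes>\<^sub>M borel"
    and eq': "(\<lambda>\<omega>. (discount n \<omega>, post_level \<mu> x n \<omega>)) = (\<lambda>\<omega>. f (restrict (\<lambda>i. case_sum \<tau> W i \<omega>) (?A n)))"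
    using Suc.IH by blast
  note eq = fun_cong[OF eq']
  define q where "q v = f (restrict v (?A n))" for v
  have [measurable]: "q \<in> ?N \<rightarrow>\<^sub>M borel \<Otimes>\<^sub>M borel"
    unfolding q_def by (rule measurable_compose[OF measurable_restrict_subset f]) auto
  have [measurable]: "(\<lambda>v. v (Inl n)) \<in> borel_measurable ?N" "(\<lambda>v. v (Inr n)) \<in> borel_measurable ?N"
    by (rule measurable_component_singleton, simp)+
  define l where "l v = refill S (snd (q v)) (v (Inl n))" for v
  have [measurable]: "l \<in> borel_measurable ?N"
    unfolding l_def by measurable
  have [measurable]: "(\<lambda>v. \<mu> (clip (capacity S) (l v)) (clip (max_shock S) (v (Inr n)))) \<in> borel_measurable ?N"
    by (rule regularD[OF policy_regular[OF \<mu>]]) measurable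
  let ?f = "\<lambda>v. (fst (q v) * exp (- discount_rate S * v (Inl n)),
      clip (capacity S) (l v) - \<mu> (clip (capacity S) (l v)) (clip (max_shock S) (v (Inr n))))"
  show ?case
  proof (rule bexI[of _ ?f])
    show "?f \<in> ?N \<rightarrow>\<^sub>M borel \<Otimes>\<^sub>M borel" by measurable
    have q: "q (restrict (\<lambda>i. case_sum \<tau> W i \<omega>) (?A (Suc n))) = (discount n \<omega>, post_level \<mu> x n \<omega>)" for \<omega>
    proof -
      have "?A (Suc n) \<inter> ?A n = ?A n" by auto
      then show ?thesis
        unfolding q_def eq restrict_restrict by simp
    qed
    show "(\<lambda>\<omega>. (discount (Suc n) \<omega>, post_level \<mu> x (Suc n) \<omega>)) =
        (\<lambda>\<omega>. ?f (restrict (\<lambda>i. case_sum \<tau> W i \<omega>) (?A (Suc n))))"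
      unfolding l_def q by (rule ext) (simp add: Let_def discount_simps)
  qed
qed

lemma measurable_state [measurable]:
  "discount n \<in> borel_measurable M" "post_level \<mu> x n \<in> borel_measurable M" "pre_level \<mu> x n \<in> borel_measurable M"
proof -
  let ?A = "Inl ` {..<n} \<union> Inr ` {..<n} :: (nat + nat) set"
  obtain f where f: "f \<in> (PiM ?A (\<lambda>_. borel)) \<rightarrow>\<^sub>M borel \<Otimes>\<^sub>M borel"
    and eq: "(\<lambda>\<omega>. (discount n \<omega>, post_level \<mu> x n \<omega>)) = (\<lambda>\<omega>. f (restrict (\<lambda>i. case_sum \<tau> W i \<omega>) ?A))"
    using past_state[of n] by blast
  have "(\<lambda>\<omega>. restrict (\<lambda>i. case_sum \<tau> W i \<omega>) ?A) \<in> M \<rightarrow>\<^sub>M PiM ?A (\<lambda>_. borel)"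
    by (rule measurable_restrict) (auto split: sum.split)
  from measurable_compose[OF this f] have m: "(\<lambda>\<omega>. (discount n \<omega>, post_level \<mu> x n \<omega>)) \<in> M \<rightarrow>\<^sub>M borel \<Otimes>\<^sub>M borel"
    unfolding eq .
  show "discount n \<in> borel_measurable M"
    using measurable_compose[OF m measurable_fst] by simp
  show [measurable]: "post_level \<mu> x n \<in> borel_measurable M"
    using measurable_compose[OF m measurable_snd] by simp
  show "pre_level \<mu> x n \<in> borel_measurable M"
    unfolding pre_level_def by measurable
qed

lemma past_indep_next:
  "P.indep_var (borel \<Otimes>\<^sub>M borel) (\<lambda>\<omega>. (discount n \<omega>, post_level \<mu> x n \<omega>)) (borel \<Otimes>\<^sub>M borel) (\<lambda>\<omega>. (\<tau> n \<omega>, W n \<omega>))"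
proof -
  let ?A = "Inl ` {..<n} \<union> Inr ` {..<n} :: (nat + nat) set" and ?B = "{Inl n, Inr n} :: (nat + nat) set"
  obtain f where f: "f \<in> (PiM ?A (\<lambda>_. borel)) \<rightarrow>\<^sub>M borel \<Otimes>\<^sub>M borel"
    and eq: "(\<lambda>\<omega>. (discount n \<omega>, post_level \<mu> x n \<omega>)) = (\<lambda>\<omega>. f (restrict (\<lambda>i. case_sum \<tau> W i \<omega>) ?A))"
    using past_state[of n] by blast
  have ind: "P.indep_var (PiM ?A (\<lambda>_. borel)) (\<lambda>\<omega>. restrict (\<lambda>i. case_sum \<tau> W i \<omega>) ?A)
      (PiM ?B (\<lambda>_. borel)) (\<lambda>\<omega>. restrict (\<lambda>i. case_sum \<tau> W i \<omega>) ?B)"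
    by (rule P.indep_var_restrict[OF indep]) auto
  have h: "(\<lambda>v. (v (Inl n), v (Inr n))) \<in> (PiM ?B (\<lambda>_. borel)) \<rightarrow>\<^sub>M (borel \<Otimes>\<^sub>M borel :: (real \<times> real) measure)"
    by (intro measurable_Pair measurable_component_singleton) auto
  show ?thesis
    using P.indep_var_compose[OF ind f h] unfolding eq by (simp add: o_def)
qed

lemma distr_next: "distr M (borel \<Otimes>\<^sub>M borel) (\<lambda>\<omega>. (\<tau> n \<omega>, W n \<omega>)) = law"
proof -
  have ind: "P.indep_var (PiM {Inl n} (\<lambda>_. borel)) (\<lambda>\<omega>. restrict (\<lambda>i. case_sum \<tau> W i \<omega>) {Inl n})
      (PiM {Inr n} (\<lambda>_. borel)) (\<lambda>\<omega>. restrict (\<lambda>i. case_sum \<tau> W i \<omega>) {Inr n})"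
    by (rule P.indep_var_restrict[OF indep]) auto
  have "P.indep_var borel (\<tau> n) borel (W n)"
    using P.indep_var_compose[OF ind measurable_component_singleton[of "Inl n"] measurable_component_singleton[of "Inr n"]]
    by (simp add: o_def)
  then have "distr M borel (\<tau> n) \<Otimes>\<^sub>M distr M borel (W n) = distr M (borel \<Otimes>\<^sub>M borel) (\<lambda>\<omega>. (\<tau> n \<omega>, W n \<omega>))"
    by (simp add: P.indep_var_distribution_eq)
  moreover have "distr M borel (\<tau> n) = gap_law S" "distr M borel (W n) = size_law S"
    using shocks by (auto simp: shock_process_def)
  ultimately show ?thesis by simp
qed

lemma integrable_discount: "integrable M (discount n)"
proof (rule P.integrable_const_bound[where B=1])
  show "AE \<omega> in M. norm (discount n \<omega>) \<le> 1"
    using discount_bounds[of _ n] by (intro AE_I2) (auto simp: abs_of_pos)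
qed measurable

lemma measurable_stage_value:
  assumes "regular \<psi>"
  shows "(\<lambda>\<omega>. discount (Suc n) \<omega> * \<psi> (pre_level \<mu> x n \<omega>) (W n \<omega>)) \<in> borel_measurable M"
proof -
  have [measurable]: "(\<lambda>\<omega>. \<psi> (clip (capacity S) (pre_level \<mu> x n \<omega>)) (clip (max_shock S) (W n \<omega>))) \<in> borel_measurable M"
    by (rule regularD[OF assms]) measurable
  have "(\<lambda>\<omega>. discount (Suc n) \<omega> * \<psi> (clip (capacity S) (pre_level \<mu> x n \<omega>)) (clip (max_shock S) (W n \<omega>))) \<in> borel_measurable M"
    by measurable
  then show ?thesis
    by (rule measurable_cong[THEN iffD1, rotated])
      (use pre_level_in size_in in \<open>simp del: atLeastAtMost_iff\<close>)
qed

lemma stage_value_bound: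
  assumes "\<And>s w. s \<in> levels \<Longrightarrow> w \<in> sizes \<Longrightarrow> \<bar>\<psi> s w\<bar> \<le> C" "\<omega> \<in> space M"
  shows "\<bar>discount (Suc n) \<omega> * \<psi> (pre_level \<mu> x n \<omega>) (W n \<omega>)\<bar> \<le> C * discount (Suc n) \<omega>"
proof -
  have "\<bar>\<psi> (pre_level \<mu> x n \<omega>) (W n \<omega>)\<bar> \<le> C"
    by (intro assms(1) pre_level_in size_in assms(2))
  then show ?thesis
    using discount_bounds(1)[OF assms(2), of "Suc n"] by (simp add: abs_mult abs_of_pos mult.commute[of C])
qed

lemma integrable_stage_value:
  assumes "regular \<psi>"
  shows "integrable M (\<lambda>\<omega>. discount (Suc n) \<omega> * \<psi> (pre_level \<mu> x n \<omega>) (W n \<omega>))"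
proof -
  obtain C where C: "\<And>s w. s \<in> levels \<Longrightarrow> w \<in> sizes \<Longrightarrow> \<bar>\<psi> s w\<bar> \<le> C"
    using assms unfolding regular_def by blast
  show ?thesis
  proof (rule Bochner_Integration.integrable_bound)
    show "integrable M (\<lambda>\<omega>. C * discount (Suc n) \<omega>)"
      by (intro integrable_mult_right integrable_discount)
    show "AE \<omega> in M. norm (discount (Suc n) \<omega> * \<psi> (pre_level \<mu> x n \<omega>) (W n \<omega>)) \<le> norm (C * discount (Suc n) \<omega>)"
    proof (rule AE_I2)
      fix \<omega> assume "\<omega> \<in> space M"
      then have "\<bar>discount (Suc n) \<omega> * \<psi> (pre_level \<mu> x n \<omega>) (W n \<omega>)\<bar> \<le> C * discount (Suc n) \<omega>"
        by (intro stage_value_bound C)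
      then show "norm (discount (Suc n) \<omega> * \<psi> (pre_level \<mu> x n \<omega>) (W n \<omega>)) \<le> norm (C * discount (Suc n) \<omega>)"
        unfolding real_norm_def by linarith
    qed
  qed (rule measurable_stage_value[OF assms])
qed

text \<open>
  Given the past, the next waiting time and shock size have their joint product law, so that
  conditioning on the past turns a reward into its expected continuation.
\<close>

lemma markov_property:
  assumes "regular \<psi>"
  shows "discounted_mean \<mu> x n \<psi> = P.expectation (\<lambda>\<omega>. discount n \<omega> * expected_continuation S \<psi> (post_level \<mu> x n \<omega>))"
proof -
  let ?B = "borel \<Otimes>\<^sub>M borel :: (real \<times> real) measure"
  define h where "h p = fst (fst p) * continuation_integrand (\<lambda>s w. \<psi> (clip (capacity S) s) (clip (max_shock S) w))
      (clip (capacity S) (snd (fst p))) (snd p)" for p :: "(real \<times> real) \<times> (real \<times> real)"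
  have [measurable]: "(\<lambda>p. \<psi> (clip (capacity S) (refill S (clip (capacity S) (snd (fst p))) (fst (snd p))))
      (clip (max_shock S) (snd (snd p)))) \<in> borel_measurable (?B \<Otimes>\<^sub>M ?B)"
    by (rule regularD[OF assms]) measurable
  have [measurable]: "h \<in> borel_measurable (?B \<Otimes>\<^sub>M ?B)"
    unfolding h_def continuation_integrand_def by measurable
  have h: "h ((discount n \<omega>, post_level \<mu> x n \<omega>), z) = discount n \<omega> * continuation_integrand \<psi> (post_level \<mu> x n \<omega>) z" for \<omega> z
    unfolding h_def using continuation_integrand_clip[OF post_level_in[of n \<omega>], of \<psi>] clip_id[OF post_level_in[of n \<omega>]] by simp
  have h_now: "h ((discount n \<omega>, post_level \<mu> x n \<omega>), (\<tau> n \<omega>, W n \<omega>)) = discount (Suc n) \<omega> * \<psi> (pre_level \<mu> x n \<omega>) (W n \<omega>)"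
    if "\<omega> \<in> space M" for \<omega>
    using gap_pos[OF that, of n] size_in[OF that, of n] unfolding h continuation_integrand_def pre_level_def by (simp add: discount_simps)
  have "discounted_mean \<mu> x n \<psi> = P.expectation (\<lambda>\<omega>. h ((discount n \<omega>, post_level \<mu> x n \<omega>), (\<tau> n \<omega>, W n \<omega>)))"
    unfolding discounted_mean_def by (rule Bochner_Integration.integral_cong) (simp_all add: h_now)
  also have "\<dots> = P.expectation (\<lambda>\<omega>. \<integral>z. h ((discount n \<omega>, post_level \<mu> x n \<omega>), z) \<partial>distr M ?B (\<lambda>\<omega>. (\<tau> n \<omega>, W n \<omega>)))"
  proof (rule P.indep_var_expectation_iterated[OF past_indep_next])
    show "integrable M (\<lambda>\<omega>. h ((discount n \<omega>, post_level \<mu> x n \<omega>), (\<tau> n \<omega>, W n \<omega>)))"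
      using integrable_stage_value[OF assms, of n]
      by (rule Bochner_Integration.integrable_cong[THEN iffD1, rotated -1]) (simp_all add: h_now)
  qed measurable
  also have "\<dots> = P.expectation (\<lambda>\<omega>. discount n \<omega> * expected_continuation S \<psi> (post_level \<mu> x n \<omega>))"
    unfolding distr_next h expected_continuation_eq by simp
  finally show ?thesis .
qed

lemma expectation_discount: "P.expectation (discount n) = discount_factor ^ n"
proof (induction n)
  case 0
  show ?case by (simp add: discount_def P.prob_space)
next
  case (Suc n)
  have "P.expectation (discount (Suc n)) = discounted_mean \<mu> x n (\<lambda>_ _. 1)"
    by (simp add: discounted_mean_def)
  also have "\<dots> = P.expectation (\<lambda>\<omega>. discount n \<omega> * discount_factor)"
    unfolding markov_property[OF regular_const] expected_continuation_one[OF post_level_in] ..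
  finally show ?case using Suc.IH by simp
qed

lemma discounted_mean_bound:
  assumes "regular \<psi>" "\<And>s w. s \<in> levels \<Longrightarrow> w \<in> sizes \<Longrightarrow> \<bar>\<psi> s w\<bar> \<le> C"
  shows "\<bar>discounted_mean \<mu> x n \<psi>\<bar> \<le> C * discount_factor ^ Suc n"
    and "P.expectation (\<lambda>\<omega>. \<bar>discount (Suc n) \<omega> * \<psi> (pre_level \<mu> x n \<omega>) (W n \<omega>)\<bar>) \<le> C * discount_factor ^ Suc n"
proof -
  have "P.expectation (\<lambda>\<omega>. \<bar>discount (Suc n) \<omega> * \<psi> (pre_level \<mu> x n \<omega>) (W n \<omega>)\<bar>)
      \<le> P.expectation (\<lambda>\<omega>. C * discount (Suc n) \<omega>)"
    by (rule integral_mono)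
      (use integrable_stage_value[OF assms(1)] integrable_discount stage_value_bound[OF assms(2)]
        in \<open>auto simp del: atLeastAtMost_iff\<close>)
  also have "\<dots> = C * discount_factor ^ Suc n"
    by (simp only: integral_mult_right_zero expectation_discount)
  finally show *: "P.expectation (\<lambda>\<omega>. \<bar>discount (Suc n) \<omega> * \<psi> (pre_level \<mu> x n \<omega>) (W n \<omega>)\<bar>) \<le> C * discount_factor ^ Suc n" .
  show "\<bar>discounted_mean \<mu> x n \<psi>\<bar> \<le> C * discount_factor ^ Suc n"
    unfolding discounted_mean_def by (rule order_trans[OF integral_abs_bound *])
qed

lemma summable_powers: "summable (\<lambda>n. C * discount_factor ^ Suc n)"
  using discount_factor_bounds by (intro summable_mult) (simp add: summable_mult)

lemma summable_discounted_mean: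
  assumes "regular \<psi>"
  shows "summable (\<lambda>n. discounted_mean \<mu> x n \<psi>)"
proof -
  obtain C where C: "\<And>s w. s \<in> levels \<Longrightarrow> w \<in> sizes \<Longrightarrow> \<bar>\<psi> s w\<bar> \<le> C"
    using assms unfolding regular_def by blast
  show ?thesis
    by (rule summable_comparison_test'[OF summable_powers[of C], of 0])
      (use discounted_mean_bound(1)[OF assms C] in \<open>simp del: power_Suc\<close>)
qed

text \<open>
  Sum and expectation may be exchanged since the expected discounts form a geometric series; the
  same series shows that the discounts, and with them the costs, are almost surely summable.
\<close>

lemma policy_cost_eq:
  assumes "regular (\<lambda>s w. stage_cost S (w - \<mu> s w))"
  shows "policy_cost S M \<tau> W \<mu> x = (\<Sum>n. discounted_mean \<mu> x n (\<lambda>s w. stage_cost S (w - \<mu> s w)))"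
proof -
  let ?c = "\<lambda>s w. stage_cost S (w - \<mu> s w)"
  let ?f = "\<lambda>n \<omega>. discount (Suc n) \<omega> * ?c (pre_level \<mu> x n \<omega>) (W n \<omega>)"
  obtain C where C: "\<And>s w. s \<in> levels \<Longrightarrow> w \<in> sizes \<Longrightarrow> \<bar>?c s w\<bar> \<le> C"
    using assms unfolding regular_def by blast
  have "policy_cost S M \<tau> W \<mu> x = P.expectation (\<lambda>\<omega>. \<Sum>n. ?f n \<omega>)"
    unfolding policy_cost_def
    by (rule Bochner_Integration.integral_cong)
      (simp_all only: exp_arrival_time level_before_eq)
  also have "\<dots> = (\<Sum>n. P.expectation (?f n))"
  proof (rule integral_suminf)
    show "integrable M (?f n)" for n
      by (rule integrable_stage_value[OF assms])
    have "AE \<omega> in M. summable (\<lambda>n. discount n \<omega>)"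
      using discount_bounds(1) discount_factor_bounds
      by (intro AE_summable_of_expectations integrable_discount) (auto simp: expectation_discount less_imp_le)
    with AE_space show "AE \<omega> in M. summable (\<lambda>n. norm (?f n \<omega>))"
    proof eventually_elim
      case (elim \<omega>)
      then have "summable (\<lambda>n. C * discount (Suc n) \<omega>)"
        using summable_Suc_iff[of "\<lambda>n. discount n \<omega>"] by (intro summable_mult) simp
      then show ?case
        by (rule summable_comparison_test'[of _ 0])
          (use stage_value_bound[OF C elim(1)] in simp)
    qed
    show "summable (\<lambda>n. P.expectation (\<lambda>\<omega>. norm (?f n \<omega>)))"
      by (rule summable_comparison_test'[OF summable_powers[of C], of 0])
        (use discounted_mean_bound(2)[OF assms C] in \<open>simp del: power_Suc add: integral_nonneg\<close>)
  qed
  finally show ?thesis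
    unfolding discounted_mean_def .
qed

end

end

section \<open>Rewards that the process cannot see\<close>

context storage
begin

lemma mean_over_size_zero_iff:
  assumes "regular \<psi>" "\<And>s w. s \<in> levels \<Longrightarrow> w \<in> sizes \<Longrightarrow> 0 \<le> \<psi> s w" and y: "y \<in> levels"
  shows "0 \<le> mean_over_size \<psi> y"
    and "mean_over_size \<psi> y = 0 \<longleftrightarrow> (AE w in size_law S. w \<in> sizes \<longrightarrow> \<psi> y w = 0)"
proof -
  obtain C where C: "\<And>s w. s \<in> levels \<Longrightarrow> w \<in> sizes \<Longrightarrow> \<bar>\<psi> s w\<bar> \<le> C"
    using assms(1) unfolding regular_def by blast
  have "0 \<le> C" using C[OF zero_in(1,3)] by linarith
  let ?f = "\<lambda>w. indicator sizes w * \<psi> y w"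
  have [measurable]: "(\<lambda>w. \<psi> (clip (capacity S) y) (clip (max_shock S) w)) \<in> borel_measurable (size_law S)"
    by (rule regularD[OF assms(1)]) measurable
  have f_eq: "?f = (\<lambda>w. indicator sizes w * \<psi> (clip (capacity S) y) (clip (max_shock S) w))"
    using y by (intro ext) (simp add: indicator_def)
  have int: "integrable (size_law S) ?f"
  proof (rule size.integrable_const_bound[where B=C])
    show "AE w in size_law S. norm (?f w) \<le> C"
      using C[OF y] \<open>0 \<le> C\<close> by (intro AE_I2) (simp add: indicator_def)
    show "?f \<in> borel_measurable (size_law S)"
      unfolding f_eq by measurable
  qed
  have nn: "0 \<le> ?f w" for w
    using assms(2)[OF y] by (simp add: indicator_def)
  show "0 \<le> mean_over_size \<psi> y"
    unfolding mean_over_size_def by (rule Bochner_Integration.integral_nonneg[OF nn])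
  have "mean_over_size \<psi> y = 0 \<longleftrightarrow> (AE w in size_law S. ?f w = 0)"
    unfolding mean_over_size_def by (rule integral_nonneg_eq_0_iff_AE[OF int]) (use nn in simp)
  also have "\<dots> \<longleftrightarrow> (AE w in size_law S. w \<in> sizes \<longrightarrow> \<psi> y w = 0)"
    by (rule AE_cong) (auto simp: indicator_def)
  finally show "mean_over_size \<psi> y = 0 \<longleftrightarrow> (AE w in size_law S. w \<in> sizes \<longrightarrow> \<psi> y w = 0)" .
qed

lemma measurable_mean_over_size:
  assumes "regular \<psi>"
  shows "(\<lambda>y. mean_over_size \<psi> (clip (capacity S) y)) \<in> borel_measurable borel"
proof -
  have [measurable]: "(\<lambda>p. \<psi> (clip (capacity S) (fst p)) (clip (max_shock S) (snd p))) \<in> borel_measurable (borel \<Otimes>\<^sub>M size_law S)"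
    by (rule regularD[OF assms]) measurable
  have "mean_over_size \<psi> (clip (capacity S) y) =
      (\<integral>w. indicator sizes w * \<psi> (clip (capacity S) y) (clip (max_shock S) w) \<partial>size_law S)" for y
    unfolding mean_over_size_def by (rule Bochner_Integration.integral_cong) (auto simp: indicator_def)
  moreover have "(\<lambda>y. \<integral>w. indicator sizes w * \<psi> (clip (capacity S) y) (clip (max_shock S) w) \<partial>size_law S)
      \<in> borel_measurable borel"
    by (rule size.borel_measurable_lebesgue_integral) (simp add: case_prod_beta')
  ultimately show ?thesis by simp
qed

lemma expected_continuation_nonneg:
  assumes "\<And>s w. s \<in> levels \<Longrightarrow> w \<in> sizes \<Longrightarrow> 0 \<le> \<psi> s w" "x \<in> levels"
  shows "0 \<le> expected_continuation S \<psi> x"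
  unfolding expected_continuation_eq
proof (rule Bochner_Integration.integral_nonneg)
  fix p
  show "0 \<le> continuation_integrand \<psi> x p"
  proof (cases "p \<in> {0..} \<times> sizes")
    case True
    then have "0 \<le> \<psi> (refill S x (fst p)) (snd p)"
      by (intro assms(1) refill_in assms(2)) auto
    then show ?thesis by (simp add: continuation_integrand_def)
  qed (simp add: continuation_integrand_def)
qed

lemma expected_continuation_zero_iff:
  assumes reg: "regular \<psi>" and nn: "\<And>s w. s \<in> levels \<Longrightarrow> w \<in> sizes \<Longrightarrow> 0 \<le> \<psi> s w" and x: "x \<in> levels"
  shows "expected_continuation S \<psi> x = 0 \<longleftrightarrow>
    (AE t in lborel. 0 \<le> t \<longrightarrow> mean_over_size \<psi> (refill S x t) = 0)"
proof -
  have i: "integrable law (continuation_integrand \<psi> x)"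
    using regular_imp_continuation_exists[OF reg] x by (simp add: continuation_exists_eq)
  have "0 \<le> gap_integrand \<psi> x t" for t
  proof (cases "0 \<le> t")
    case True
    then have "0 \<le> mean_over_size \<psi> (refill S x t)"
      by (intro mean_over_size_zero_iff(1)[OF reg nn refill_in[OF x]])
    then show ?thesis
      using params_pos by (simp add: gap_integrand_def exponential_density_nonneg)
  qed (simp add: gap_integrand_def)
  then have "expected_continuation S \<psi> x = 0 \<longleftrightarrow> (AE t in lborel. gap_integrand \<psi> x t = 0)"
    unfolding expected_continuation_iterated(2)[OF i]
    by (intro integral_nonneg_eq_0_iff_AE expected_continuation_iterated(1)[OF i]) simp
  also have "\<dots> \<longleftrightarrow> (AE t in lborel. 0 \<le> t \<longrightarrow> mean_over_size \<psi> (refill S x t) = 0)"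
    using params_pos by (intro AE_cong) (auto simp: gap_integrand_def exponential_density_def)
  finally show ?thesis .
qed

lemma expected_continuation_capacity:
  assumes reg: "regular \<psi>"
  shows "expected_continuation S \<psi> (capacity S) = discount_factor * mean_over_size \<psi> (capacity S)"
proof -
  have i: "integrable law (continuation_integrand J (capacity S))" if "regular J" for J
    using regular_imp_continuation_exists[OF that] by (simp add: continuation_exists_eq del: atLeastAtMost_iff)
  have "gap_integrand \<psi> (capacity S) t = gap_integrand (\<lambda>_ _. 1) (capacity S) t * mean_over_size \<psi> (capacity S)" for t
  proof (cases "0 \<le> t")
    case True
    then have "refill S (capacity S) t = capacity S"
      using params_pos by (simp add: refill_def)
    then show ?thesis by (simp add: gap_integrand_def mean_over_size_one)
  qed (simp add: gap_integrand_def)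
  then have "integral\<^sup>L lborel (gap_integrand \<psi> (capacity S)) =
      integral\<^sup>L lborel (gap_integrand (\<lambda>_ _. 1) (capacity S)) * mean_over_size \<psi> (capacity S)"
    unfolding integral_mult_left_zero[symmetric] by (intro Bochner_Integration.integral_cong) simp_all
  then show ?thesis
    using expected_continuation_one[of "capacity S"]
    unfolding expected_continuation_iterated(2)[OF i[OF reg]] expected_continuation_iterated(2)[OF i[OF regular_const]]
    by (simp del: atLeastAtMost_iff)
qed

text \<open>
  Until the first shock the level rises at constant speed and then rests at the full level, so just
  before that shock its law has a density that is positive between the initial level and the full
  one, and an atom at the full level. Starting from the empty storage detects all levels up to null
  sets, starting from the full one isolates the atom. Conversely, the two conditions cover the law
  from any initial level.
\<close>

lemma expected_continuation_zero_AE: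
  assumes reg: "regular \<psi>" and nn: "\<And>s w. s \<in> levels \<Longrightarrow> w \<in> sizes \<Longrightarrow> 0 \<le> \<psi> s w"
  shows "(\<forall>x\<in>levels. expected_continuation S \<psi> x = 0) \<longleftrightarrow>
    (AE p in lborel \<Otimes>\<^sub>M size_law S. fst p \<in> levels \<and> snd p \<in> sizes \<longrightarrow> \<psi> (fst p) (snd p) = 0) \<and>
    (AE w in size_law S. w \<in> sizes \<longrightarrow> \<psi> (capacity S) w = 0)"
proof -
  let ?r = "ramp_rate S" and ?h = "\<lambda>y. mean_over_size \<psi> (clip (capacity S) y)"
  interpret LS: pair_sigma_finite lborel "size_law S" ..
  note [measurable] = measurable_mean_over_size[OF reg]
  have h0: "mean_over_size \<psi> y = 0 \<longleftrightarrow> (AE w in size_law S. w \<in> sizes \<longrightarrow> \<psi> y w = 0)" if "y \<in> levels" for y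
    by (intro mean_over_size_zero_iff(2) reg nn that)
  have full: "expected_continuation S \<psi> (capacity S) = 0 \<longleftrightarrow> (AE w in size_law S. w \<in> sizes \<longrightarrow> \<psi> (capacity S) w = 0)"
    using discount_factor_bounds h0[OF zero_in(2)] by (simp add: expected_continuation_capacity[OF reg])
  have zero: "expected_continuation S \<psi> x = 0 \<longleftrightarrow> (AE t in lborel. 0 \<le> t \<longrightarrow> ?h (refill S x t) = 0)"
    if "x \<in> levels" for x
  proof -
    have "expected_continuation S \<psi> x = 0 \<longleftrightarrow>
        (AE t in lborel. 0 \<le> t \<longrightarrow> mean_over_size \<psi> (refill S x t) = 0)"
      by (intro expected_continuation_zero_iff reg nn that)
    also have "\<dots> \<longleftrightarrow> (AE t in lborel. 0 \<le> t \<longrightarrow> ?h (refill S x t) = 0)"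
      by (rule AE_cong) (use refill_in[OF that] in \<open>auto simp del: atLeastAtMost_iff\<close>)
    finally show ?thesis .
  qed
  have AE_levels: "(AE p in lborel \<Otimes>\<^sub>M size_law S. fst p \<in> levels \<and> snd p \<in> sizes \<longrightarrow> \<psi> (fst p) (snd p) = 0)
      \<longleftrightarrow> (AE y in lborel. y \<in> levels \<longrightarrow> ?h y = 0)"
  proof -
    let ?P = "\<lambda>y w. y \<in> levels \<and> w \<in> sizes \<longrightarrow> \<psi> (clip (capacity S) y) (clip (max_shock S) w) = 0"
    have [measurable]: "(\<lambda>p. \<psi> (clip (capacity S) (fst p)) (clip (max_shock S) (snd p))) \<in> borel_measurable (lborel \<Otimes>\<^sub>M size_law S)"
      by (rule regularD[OF reg]) measurable
    have "(AE p in lborel \<Otimes>\<^sub>M size_law S. fst p \<in> levels \<and> snd p \<in> sizes \<longrightarrow> \<psi> (fst p) (snd p) = 0)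
        \<longleftrightarrow> (AE p in lborel \<Otimes>\<^sub>M size_law S. ?P (fst p) (snd p))"
      by (rule AE_cong) auto
    also have "\<dots> \<longleftrightarrow> (AE y in lborel. AE w in size_law S. ?P y w)"
      by (rule LS.AE_pair_iff[symmetric]) measurable
    also have "\<dots> \<longleftrightarrow> (AE y in lborel. y \<in> levels \<longrightarrow> ?h y = 0)"
    proof (rule AE_cong)
      fix y
      show "(AE w in size_law S. ?P y w) = (y \<in> levels \<longrightarrow> ?h y = 0)"
      proof (cases "y \<in> levels")
        case True
        have "(AE w in size_law S. ?P y w) \<longleftrightarrow> (AE w in size_law S. w \<in> sizes \<longrightarrow> \<psi> y w = 0)"
          using True by (intro AE_cong) auto
        then show ?thesis using True h0[OF True] by (simp del: atLeastAtMost_iff)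
      next
        case False
        then show ?thesis by (simp del: atLeastAtMost_iff)
      qed
    qed
    finally show ?thesis .
  qed
  have r: "?r \<noteq> 0" using params_pos by simp
  show ?thesis
  proof
    assume *: "\<forall>x\<in>levels. expected_continuation S \<psi> x = 0"
    let ?P = "\<lambda>t. 0 \<le> t \<longrightarrow> ?h (refill S 0 t) = 0"
    \<comment> \<open>from the empty storage the level \<open>y < cap\<close> is reached at time \<open>y / r\<close>\<close>
    have "AE t in lborel. ?P t"
      using * zero[OF zero_in(1)] zero_in(1) by blast
    moreover have "Measurable.pred borel ?P"
      by measurable
    ultimately have "AE y in lborel. ?P (0 + (1 / ?r) * y)"
      using r by (intro AE_borel_affine) auto
    then have "AE y in lborel. y \<in> levels \<longrightarrow> ?h y = 0"
      by eventually_elim (use params_pos in \<open>auto simp: refill_def min_def\<close>)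
    with * full zero_in(2) AE_levels
    show "(AE p in lborel \<Otimes>\<^sub>M size_law S. fst p \<in> levels \<and> snd p \<in> sizes \<longrightarrow> \<psi> (fst p) (snd p) = 0) \<and>
        (AE w in size_law S. w \<in> sizes \<longrightarrow> \<psi> (capacity S) w = 0)"
      by blast
  next
    assume *: "(AE p in lborel \<Otimes>\<^sub>M size_law S. fst p \<in> levels \<and> snd p \<in> sizes \<longrightarrow> \<psi> (fst p) (snd p) = 0) \<and>
        (AE w in size_law S. w \<in> sizes \<longrightarrow> \<psi> (capacity S) w = 0)"
    let ?P = "\<lambda>y. y \<in> levels \<longrightarrow> ?h y = 0"
    have P: "AE y in lborel. ?P y" using * AE_levels by blast
    have hc: "?h (capacity S) = 0"
      using * h0[OF zero_in(2)] zero_in(2) by (simp del: atLeastAtMost_iff)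
    show "\<forall>x\<in>levels. expected_continuation S \<psi> x = 0"
    proof
      fix x assume x: "x \<in> levels"
      \<comment> \<open>before the storage is full the level is affine in time, so null sets of levels pull back\<close>
      have "Measurable.pred borel ?P" by measurable
      from AE_borel_affine[OF r this P, of x] have "AE t in lborel. 0 \<le> t \<longrightarrow> ?h (refill S x t) = 0"
      proof eventually_elim
        case (elim t)
        show ?case
        proof
          assume t: "0 \<le> t"
          show "?h (refill S x t) = 0"
          proof (cases "x + ?r * t \<le> capacity S")
            case True
            moreover have "0 \<le> x + ?r * t" using x t params_pos by simp
            ultimately show ?thesis using elim by (simp add: refill_def)
          next
            case False
            then have "refill S x t = capacity S" by (simp add: refill_def)
            then show ?thesis using hc by simp
          qed
        qed
      qed
      then show "expected_continuation S \<psi> x = 0" using zero[OF x] by blast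
    qed
  qed
qed

section \<open>Performance difference\<close>

definition bellman_gap :: "(real \<Rightarrow> real \<Rightarrow> real) \<Rightarrow> (real \<Rightarrow> real \<Rightarrow> real) \<Rightarrow> real \<Rightarrow> real \<Rightarrow> real" where
  "bellman_gap J \<mu> s w = action_cost S J s w (\<mu> s w) - J s w"

lemma action_cost_regular:
  assumes "continuation_exists S J" "\<mu> \<in> policies S"
  shows "regular (\<lambda>s w. action_cost S J s w (\<mu> s w))"
  unfolding action_cost_def by (rule action_regular[OF continuous_expected_continuation[OF assms(1)] assms(2)])

lemma bellman_gap_regular: "regular J \<Longrightarrow> \<mu> \<in> policies S \<Longrightarrow> regular (bellman_gap J \<mu>)"
  unfolding bellman_gap_def[abs_def] by (intro regular_diff action_cost_regular regular_imp_continuation_exists)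

lemma stage_cost_regular: "\<mu> \<in> policies S \<Longrightarrow> regular (\<lambda>s w. stage_cost S (w - \<mu> s w))"
  using action_regular[of "\<lambda>_. 0" \<mu>] by simp

lemma bellman_le_action:
  assumes "continuation_exists S J" "s \<in> levels" "w \<in> sizes" "u \<in> {0..min s w}"
  shows "bellman S J s w \<le> action_cost S J s w u"
  unfolding bellman_eq action_cost_def
  by (rule optimal_value_le[OF continuous_expected_continuation[OF assms(1)] assms(2-)])

lemma bellman_attained:
  assumes "continuation_exists S J"
  shows "\<exists>\<mu>\<in>policies S. \<forall>s\<in>levels. \<forall>w\<in>sizes. bellman S J s w = action_cost S J s w (\<mu> s w)"
proof -
  obtain \<mu> where "\<mu> \<in> policies S" "greedy_for (expected_continuation S J) \<mu>"
    using greedy_policy_exists[OF continuous_expected_continuation[OF assms]] by blast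
  then show ?thesis
    unfolding bellman_eq action_cost_def using optimal_value_greedy by blast
qed

end

context storage_process
begin

context
  fixes \<mu> x
  assumes \<mu>: "\<mu> \<in> policies S" and x: "x \<in> levels"
begin

lemma discounted_mean_diff:
  assumes "regular \<psi>" "regular \<phi>"
  shows "discounted_mean \<mu> x n (\<lambda>s w. \<psi> s w - \<phi> s w) = discounted_mean \<mu> x n \<psi> - discounted_mean \<mu> x n \<phi>"
  unfolding discounted_mean_def right_diff_distrib
  by (rule Bochner_Integration.integral_diff) (intro integrable_stage_value \<mu> x assms)+

lemma discounted_mean_nonneg:
  assumes "\<And>s w. s \<in> levels \<Longrightarrow> w \<in> sizes \<Longrightarrow> 0 \<le> \<psi> s w"
  shows "0 \<le> discounted_mean \<mu> x n \<psi>"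
  unfolding discounted_mean_def
proof (rule integral_nonneg_AE, rule AE_I2)
  fix \<omega> assume \<omega>: "\<omega> \<in> space M"
  have "0 \<le> \<psi> (pre_level \<mu> x n \<omega>) (W n \<omega>)"
    by (intro assms pre_level_in \<mu> x size_in \<omega>)
  then show "0 \<le> discount (Suc n) \<omega> * \<psi> (pre_level \<mu> x n \<omega>) (W n \<omega>)"
    using discount_bounds(1)[OF \<omega>, of "Suc n"] by simp
qed

text \<open>
  With \<open>c\<close> the stage cost and \<open>d\<close> the gap of \<open>\<mu>\<close>, the definition of the gap reads
  \<open>c = J - V (level after the action) + d\<close>. In expectation, the discounted \<open>J\<close> at shock \<open>n\<close> equals the
  discounted \<open>V\<close> after the preceding shock by the Markov property, so that the first two terms
  telescope to \<open>V x\<close>, and the remainder vanishes because of discounting.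
\<close>

lemma performance_difference:
  assumes J: "regular J"
  shows "policy_cost S M \<tau> W \<mu> x =
    expected_continuation S J x + (\<Sum>n. discounted_mean \<mu> x n (bellman_gap J \<mu>))"
proof -
  let ?V = "expected_continuation S J" and ?m = "discounted_mean \<mu> x"
  let ?c = "\<lambda>s w. stage_cost S (w - \<mu> s w)" and ?a = "\<lambda>s w. action_cost S J s w (\<mu> s w)"
  let ?v = "\<lambda>s w. ?a s w - ?c s w"
  define A where "A n = P.expectation (\<lambda>\<omega>. discount n \<omega> * ?V (post_level \<mu> x n \<omega>))" for n
  note regs = J action_cost_regular[OF regular_imp_continuation_exists[OF J] \<mu>] stage_cost_regular[OF \<mu>]
  have A: "?m n J = A n" for n
    unfolding A_def by (rule markov_property[OF \<mu> x J])
  have A_Suc: "?m n ?v = A (Suc n)" for n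
    unfolding discounted_mean_def A_def
    by (rule Bochner_Integration.integral_cong)
      (simp_all add: post_level_Suc[OF \<mu> x] action_cost_def del: post_level.simps)
  have step: "?m n ?c = A n - A (Suc n) + ?m n (bellman_gap J \<mu>)" for n
    using discounted_mean_diff[OF regs(2,3), of n] discounted_mean_diff[OF regs(2,1), of n]
    unfolding A_Suc A bellman_gap_def[abs_def] by simp
  have "A \<longlonglongrightarrow> 0"
    using summable_LIMSEQ_zero[OF summable_discounted_mean[OF \<mu> x J]] unfolding A .
  from telescope_sums'[OF this]
  have "(\<lambda>n. A n - A (Suc n)) sums ?V x"
    by (simp add: A_def discount_simps P.prob_space)
  then have "(\<lambda>n. ?m n ?c) sums (?V x + (\<Sum>n. ?m n (bellman_gap J \<mu>)))"
    unfolding step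
    by (intro sums_add summable_sums summable_discounted_mean[OF \<mu> x] bellman_gap_regular J \<mu>)
  then show ?thesis
    unfolding policy_cost_eq[OF \<mu> x stage_cost_regular[OF \<mu>]] by (simp add: sums_iff)
qed

text \<open>
  Keeping only the first term of the series bounds the cost from below and still detects every gap
  that the process can see at its first shock.
\<close>

lemma policy_cost_bounds:
  assumes J: "regular J" and nn: "\<And>s w. s \<in> levels \<Longrightarrow> w \<in> sizes \<Longrightarrow> 0 \<le> bellman_gap J \<mu> s w"
  shows "expected_continuation S J x + expected_continuation S (bellman_gap J \<mu>) x \<le> policy_cost S M \<tau> W \<mu> x"
proof -
  have d: "regular (bellman_gap J \<mu>)" by (intro bellman_gap_regular J \<mu>)
  have "expected_continuation S (bellman_gap J \<mu>) x = discounted_mean \<mu> x 0 (bellman_gap J \<mu>)"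
    unfolding markov_property[OF \<mu> x d] by (simp add: discount_simps P.prob_space)
  also have "\<dots> = (\<Sum>n<1. discounted_mean \<mu> x n (bellman_gap J \<mu>))" by simp
  also have "\<dots> \<le> (\<Sum>n. discounted_mean \<mu> x n (bellman_gap J \<mu>))"
    by (rule sum_le_suminf) (use summable_discounted_mean[OF \<mu> x d] discounted_mean_nonneg[OF nn] in auto)
  finally show ?thesis
    unfolding performance_difference[OF J] by simp
qed

text \<open>
  Later shocks need no separate treatment: given the past, each is a first shock from some level.
\<close>

lemma policy_cost_without_gap:
  assumes J: "regular J" and zero: "\<And>y. y \<in> levels \<Longrightarrow> expected_continuation S (bellman_gap J \<mu>) y = 0"
  shows "policy_cost S M \<tau> W \<mu> x = expected_continuation S J x"
proof -
  have "discounted_mean \<mu> x n (bellman_gap J \<mu>) = 0" for n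
    unfolding markov_property[OF \<mu> x bellman_gap_regular[OF J \<mu>]] zero[OF post_level_in[OF \<mu> x]] by simp
  then show ?thesis unfolding performance_difference[OF J] by simp
qed

end

end

section \<open>Optimality\<close>

text \<open>
  The fixed point is a parameter at first, since it is identified with the optimal cost only by
  comparing it with the costs of all policies.
\<close>

locale solved_storage_process = storage_process S M \<tau> W
  for S and M :: "'a measure" and \<tau> W +
  fixes J :: "real \<Rightarrow> real \<Rightarrow> real"
  assumes J: "regular J" and fixed: "\<And>s w. s \<in> levels \<Longrightarrow> w \<in> sizes \<Longrightarrow> bellman S J s w = J s w"
begin

abbreviation "V \<equiv> expected_continuation S J"
abbreviation "Jstar \<equiv> optimal_shock_cost S M \<tau> W"

lemma continuation_exists_J: "continuation_exists S J"
  by (rule regular_imp_continuation_exists[OF J])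

lemma gap_nonneg:
  assumes "\<mu> \<in> policies S" "s \<in> levels" "w \<in> sizes"
  shows "0 \<le> bellman_gap J \<mu> s w"
  using bellman_le_action[OF continuation_exists_J assms(2,3) policy_bounds(1)[OF assms]] fixed[OF assms(2,3)]
  by (simp add: bellman_gap_def)

lemma policy_cost_ge:
  assumes "\<mu> \<in> policies S" "x \<in> levels"
  shows "V x + expected_continuation S (bellman_gap J \<mu>) x \<le> policy_cost S M \<tau> W \<mu> x"
    and "V x \<le> policy_cost S M \<tau> W \<mu> x"
proof -
  show *: "V x + expected_continuation S (bellman_gap J \<mu>) x \<le> policy_cost S M \<tau> W \<mu> x"
    by (intro policy_cost_bounds assms J gap_nonneg)
  have "0 \<le> expected_continuation S (bellman_gap J \<mu>) x"
    by (intro expected_continuation_nonneg gap_nonneg assms)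
  with * show "V x \<le> policy_cost S M \<tau> W \<mu> x" by linarith
qed

lemma policy_cost_without_pointwise_gap:
  assumes "\<mu> \<in> policies S" "x \<in> levels" "\<And>s w. s \<in> levels \<Longrightarrow> w \<in> sizes \<Longrightarrow> bellman_gap J \<mu> s w = 0"
  shows "policy_cost S M \<tau> W \<mu> x = V x"
proof (rule policy_cost_without_gap[OF assms(1,2) J])
  fix y assume "y \<in> levels"
  then have "expected_continuation S (bellman_gap J \<mu>) y = expected_continuation S (\<lambda>_ _. 0) y"
    by (rule expected_continuation_cong) (rule assms(3))
  also have "\<dots> = 0" by (simp add: expected_continuation_def)
  finally show "expected_continuation S (bellman_gap J \<mu>) y = 0" .
qed

text \<open>
  The cost of a shock exceeds \<open>J\<close> by the gap of the present action and by the loss of the future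
  policy. Both are nonnegative, so pointwise optimality forces the gap to vanish at every single
  state, not just almost everywhere.
\<close>

lemma shock_cost_eq:
  "shock_cost S M \<tau> W \<mu> s w =
    J s w + bellman_gap J \<mu> s w + (policy_cost S M \<tau> W \<mu> (s - \<mu> s w) - V (s - \<mu> s w))"
  by (simp add: shock_cost_def bellman_gap_def action_cost_def)

lemma shock_cost_ge:
  assumes "\<mu> \<in> policies S" "s \<in> levels" "w \<in> sizes"
  shows "J s w + bellman_gap J \<mu> s w \<le> shock_cost S M \<tau> W \<mu> s w" "J s w \<le> shock_cost S M \<tau> W \<mu> s w"
  using policy_cost_ge(2)[OF assms(1) policy_bounds(2)[OF assms]] gap_nonneg[OF assms]
  unfolding shock_cost_eq by linarith+

lemma greedy_policy:
  obtains \<mu> where "\<mu> \<in> policies S" "\<And>s w. s \<in> levels \<Longrightarrow> w \<in> sizes \<Longrightarrow> bellman_gap J \<mu> s w = 0"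
    "\<And>x. x \<in> levels \<Longrightarrow> policy_cost S M \<tau> W \<mu> x = V x"
    "\<And>s w. s \<in> levels \<Longrightarrow> w \<in> sizes \<Longrightarrow> shock_cost S M \<tau> W \<mu> s w = J s w"
proof -
  obtain \<mu> where \<mu>: "\<mu> \<in> policies S"
    and "\<forall>s\<in>levels. \<forall>w\<in>sizes. bellman S J s w = action_cost S J s w (\<mu> s w)"
    using bellman_attained[OF continuation_exists_J] by blast
  then have zero: "bellman_gap J \<mu> s w = 0" if "s \<in> levels" "w \<in> sizes" for s w
    using that fixed[OF that] by (simp add: bellman_gap_def del: atLeastAtMost_iff)
  have cost: "policy_cost S M \<tau> W \<mu> x = V x" if "x \<in> levels" for x
    by (rule policy_cost_without_pointwise_gap[OF \<mu> that zero])
  have "shock_cost S M \<tau> W \<mu> s w = J s w" if "s \<in> levels" "w \<in> sizes" for s w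
    unfolding shock_cost_eq using zero[OF that] cost[OF policy_bounds(2)[OF \<mu> that]] by simp
  then show ?thesis using that \<mu> zero cost by blast
qed

lemma Jstar_eq:
  assumes "s \<in> levels" "w \<in> sizes"
  shows "Jstar s w = J s w" and "attains_minimum (\<lambda>\<mu>. shock_cost S M \<tau> W \<mu> s w) (policies S)"
proof -
  obtain \<mu> where \<mu>: "\<mu> \<in> policies S" and eq: "shock_cost S M \<tau> W \<mu> s w = J s w"
    using greedy_policy assms by metis
  have le: "shock_cost S M \<tau> W \<mu> s w \<le> shock_cost S M \<tau> W \<nu> s w" if "\<nu> \<in> policies S" for \<nu>
    unfolding eq using that assms by (rule shock_cost_ge(2))
  show "Jstar s w = J s w"
    unfolding optimal_shock_cost_def using minimum_eqI[of \<mu> "policies S" "\<lambda>\<mu>. shock_cost S M \<tau> W \<mu> s w"] \<mu> le eq by simp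
  show "attains_minimum (\<lambda>\<mu>. shock_cost S M \<tau> W \<mu> s w) (policies S)"
    unfolding attains_minimum_def is_arg_min_iff using \<mu> le by blast
qed

text \<open>
  The action costs for the optimal cost and for \<open>J\<close> agree at admissible actions, since levels never
  leave the domain on which both functions are equal.
\<close>

lemma achieves_minimum_iff:
  assumes \<mu>: "\<mu> \<in> policies S" and sw: "s \<in> levels" "w \<in> sizes"
  shows "achieves_minimum S Jstar \<mu> s w \<longleftrightarrow> bellman_gap J \<mu> s w = 0"
proof -
  have eq: "action_cost S Jstar s w u = action_cost S J s w u" if "u \<in> {0..min s w}" for u
  proof -
    have "s - u \<in> levels" using that sw by auto
    then show ?thesis
      unfolding action_cost_def using expected_continuation_cong[OF _ Jstar_eq(1)] by simp
  qed
  obtain \<nu> where \<nu>: "\<nu> \<in> policies S" "bellman_gap J \<nu> s w = 0"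
    using greedy_policy sw by metis
  have "achieves_minimum S Jstar \<mu> s w \<longleftrightarrow> (\<forall>u\<in>{0..min s w}. action_cost S J s w (\<mu> s w) \<le> action_cost S J s w u)"
    unfolding achieves_minimum_def is_arg_min_iff
    using eq policy_bounds(1)[OF \<mu> sw] by (simp del: atLeastAtMost_iff)
  also have "\<dots> \<longleftrightarrow> bellman_gap J \<mu> s w = 0"
  proof
    assume *: "\<forall>u\<in>{0..min s w}. action_cost S J s w (\<mu> s w) \<le> action_cost S J s w u"
    have "action_cost S J s w (\<mu> s w) \<le> action_cost S J s w (\<nu> s w)"
      by (rule bspec[OF * policy_bounds(1)[OF \<nu>(1) sw]])
    then show "bellman_gap J \<mu> s w = 0"
      using \<nu>(2) gap_nonneg[OF \<mu> sw] by (simp add: bellman_gap_def)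
  next
    assume *: "bellman_gap J \<mu> s w = 0"
    show "\<forall>u\<in>{0..min s w}. action_cost S J s w (\<mu> s w) \<le> action_cost S J s w u"
      using * bellman_le_action[OF continuation_exists_J sw] fixed[OF sw] by (simp add: bellman_gap_def del: atLeastAtMost_iff)
  qed
  finally show ?thesis .
qed

lemma shock_cost_optimal_iff:
  assumes \<mu>: "\<mu> \<in> policies S"
  shows "(\<forall>s\<in>levels. \<forall>w\<in>sizes. shock_cost S M \<tau> W \<mu> s w = Jstar s w) \<longleftrightarrow>
    (\<forall>s\<in>levels. \<forall>w\<in>sizes. achieves_minimum S Jstar \<mu> s w)"
proof -
  have "(\<forall>s\<in>levels. \<forall>w\<in>sizes. shock_cost S M \<tau> W \<mu> s w = J s w) \<longleftrightarrow>
      (\<forall>s\<in>levels. \<forall>w\<in>sizes. bellman_gap J \<mu> s w = 0)"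
  proof (intro iffI ballI)
    fix s w assume *: "\<forall>s\<in>levels. \<forall>w\<in>sizes. shock_cost S M \<tau> W \<mu> s w = J s w" and sw: "s \<in> levels" "w \<in> sizes"
    then have "shock_cost S M \<tau> W \<mu> s w = J s w" by blast
    then show "bellman_gap J \<mu> s w = 0"
      using shock_cost_ge(1)[OF \<mu> sw] gap_nonneg[OF \<mu> sw] by linarith
  next
    fix s w assume zero: "\<forall>s\<in>levels. \<forall>w\<in>sizes. bellman_gap J \<mu> s w = 0" and sw: "s \<in> levels" "w \<in> sizes"
    have "policy_cost S M \<tau> W \<mu> (s - \<mu> s w) = V (s - \<mu> s w)"
      by (rule policy_cost_without_pointwise_gap[OF \<mu> policy_bounds(2)[OF \<mu> sw]]) (use zero in blast)
    then show "shock_cost S M \<tau> W \<mu> s w = J s w"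
      unfolding shock_cost_eq using zero sw by (simp del: atLeastAtMost_iff)
  qed
  then show ?thesis
    using Jstar_eq(1) achieves_minimum_iff[OF \<mu>] by (simp del: atLeastAtMost_iff)
qed

lemma optimal_policy_iff_cost:
  assumes \<mu>: "\<mu> \<in> policies S"
  shows "optimal_policy S M \<tau> W \<mu> \<longleftrightarrow> (\<forall>x\<in>levels. expected_continuation S (bellman_gap J \<mu>) x = 0)"
proof -
  obtain \<nu> where \<nu>: "\<nu> \<in> policies S" "\<And>x. x \<in> levels \<Longrightarrow> policy_cost S M \<tau> W \<nu> x = V x"
    using greedy_policy by metis
  have "optimal_policy S M \<tau> W \<mu> \<longleftrightarrow> (\<forall>x\<in>levels. policy_cost S M \<tau> W \<mu> x = V x)"
    unfolding optimal_policy_def is_arg_min_iff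
  proof (intro ball_cong refl)
    fix x assume x: "x \<in> levels"
    show "(\<mu> \<in> policies S \<and> (\<forall>\<nu>\<in>policies S. policy_cost S M \<tau> W \<mu> x \<le> policy_cost S M \<tau> W \<nu> x)) \<longleftrightarrow>
        policy_cost S M \<tau> W \<mu> x = V x"
      using \<mu> \<nu>(1) \<nu>(2)[OF x] policy_cost_ge(2)[OF _ x] by (metis order_antisym)
  qed
  also have "\<dots> \<longleftrightarrow> (\<forall>x\<in>levels. expected_continuation S (bellman_gap J \<mu>) x = 0)"
  proof (intro iffI ballI)
    fix x assume *: "\<forall>x\<in>levels. policy_cost S M \<tau> W \<mu> x = V x" and x: "x \<in> levels"
    have "0 \<le> expected_continuation S (bellman_gap J \<mu>) x"
      by (intro expected_continuation_nonneg gap_nonneg \<mu> x)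
    moreover have "policy_cost S M \<tau> W \<mu> x = V x" using * x by blast
    ultimately show "expected_continuation S (bellman_gap J \<mu>) x = 0"
      using policy_cost_ge(1)[OF \<mu> x] by linarith
  next
    fix x assume "\<forall>x\<in>levels. expected_continuation S (bellman_gap J \<mu>) x = 0" "x \<in> levels"
    then show "policy_cost S M \<tau> W \<mu> x = V x"
      by (intro policy_cost_without_gap \<mu> J) blast+
  qed
  finally show ?thesis .
qed

lemma optimal_policy_iff:
  assumes \<mu>: "\<mu> \<in> policies S"
  shows "optimal_policy S M \<tau> W \<mu> \<longleftrightarrow>
    (AE p in lborel \<Otimes>\<^sub>M size_law S.
       fst p \<in> levels \<and> snd p \<in> sizes \<longrightarrow> achieves_minimum S Jstar \<mu> (fst p) (snd p)) \<and>
    (AE w in size_law S. w \<in> sizes \<longrightarrow> achieves_minimum S Jstar \<mu> (capacity S) w)"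
proof -
  have "optimal_policy S M \<tau> W \<mu> \<longleftrightarrow>
      (AE p in lborel \<Otimes>\<^sub>M size_law S. fst p \<in> levels \<and> snd p \<in> sizes \<longrightarrow> bellman_gap J \<mu> (fst p) (snd p) = 0) \<and>
      (AE w in size_law S. w \<in> sizes \<longrightarrow> bellman_gap J \<mu> (capacity S) w = 0)"
    unfolding optimal_policy_iff_cost[OF \<mu>]
    by (intro expected_continuation_zero_AE bellman_gap_regular J \<mu> gap_nonneg)
  also have "\<dots> \<longleftrightarrow>
      (AE p in lborel \<Otimes>\<^sub>M size_law S.
        fst p \<in> levels \<and> snd p \<in> sizes \<longrightarrow> achieves_minimum S Jstar \<mu> (fst p) (snd p)) \<and>
      (AE w in size_law S. w \<in> sizes \<longrightarrow> achieves_minimum S Jstar \<mu> (capacity S) w)"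
    by (intro arg_cong2[where f="(\<and>)"] AE_cong)
      (use achieves_minimum_iff[OF \<mu>] zero_in(2) in \<open>auto simp del: atLeastAtMost_iff\<close>)
  finally show ?thesis .
qed

lemma Jstar_exists: "continuation_exists S Jstar"
  using continuation_exists_cong[of Jstar J] Jstar_eq(1) continuation_exists_J by blast

lemma Jstar_fixed: "s \<in> levels \<Longrightarrow> w \<in> sizes \<Longrightarrow> bellman S Jstar s w = Jstar s w"
  using bellman_cong[of Jstar J s w] Jstar_eq(1) fixed by simp

lemma Jstar_characterization:
  "(\<forall>s\<in>levels. \<forall>w\<in>sizes. K s w = Jstar s w) \<longleftrightarrow>
    continuation_exists S K \<and> (\<forall>s\<in>levels. \<forall>w\<in>sizes. K s w = bellman S K s w)"
proof (intro iffI conjI ballI)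
  assume *: "\<forall>s\<in>levels. \<forall>w\<in>sizes. K s w = Jstar s w"
  then show "continuation_exists S K"
    using continuation_exists_cong[of K Jstar] Jstar_exists by blast
  fix s w assume sw: "s \<in> levels" "w \<in> sizes"
  have "bellman S K s w = bellman S Jstar s w"
    by (rule bellman_cong) (use * sw in blast)+
  then show "K s w = bellman S K s w"
    using * sw Jstar_fixed[OF sw] by (simp del: atLeastAtMost_iff)
next
  fix s w assume *: "continuation_exists S K \<and> (\<forall>s\<in>levels. \<forall>w\<in>sizes. K s w = bellman S K s w)"
    and sw: "s \<in> levels" "w \<in> sizes"
  show "K s w = Jstar s w"
    by (rule bellman_fixed_point_unique[OF _ Jstar_exists _ Jstar_fixed sw]) (use * in auto)
qed

end

lemma (in storage) bellman_attains:
  assumes "continuation_exists S J" "s \<in> levels" "w \<in> sizes"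
  shows "attains_minimum (action_cost S J s w) {0..min s w}"
proof -
  obtain \<mu> where \<mu>: "\<mu> \<in> policies S" "\<forall>s\<in>levels. \<forall>w\<in>sizes. bellman S J s w = action_cost S J s w (\<mu> s w)"
    using bellman_attained[OF assms(1)] by blast
  then have eq: "bellman S J s w = action_cost S J s w (\<mu> s w)" using assms by blast
  show ?thesis
    unfolding attains_minimum_def is_arg_min_iff
    using policy_bounds(1)[OF \<mu>(1) assms(2,3)] bellman_le_action[OF assms] unfolding eq by blast
qed

theorem theorem1:
  fixes S :: storage_system
    and M :: "'a measure"
    and \<tau> W :: "nat \<Rightarrow> 'a \<Rightarrow> real"
  defines "X \<equiv> {0..capacity S}"
    and "Y \<equiv> {0..max_shock S}"
    and "Jstar \<equiv> optimal_shock_cost S M \<tau> W"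
  assumes "storage_model S"
    and "shock_process S M \<tau> W"
  shows
    \<comment> \<open>the minima defining \<open>Jstar\<close> and the Bellman operator exist\<close>
    "(\<forall>s\<in>X. \<forall>w\<in>Y. attains_minimum (\<lambda>\<mu>. shock_cost S M \<tau> W \<mu> s w) (policies S)) \<and>
     (\<forall>J. continuation_exists S J \<longrightarrow>
        (\<forall>s\<in>X. \<forall>w\<in>Y. attains_minimum (action_cost S J s w) {0..min s w}) \<and>
        continuation_exists S (bellman S J)) \<and>
     \<comment> \<open>characterization of \<open>Jstar\<close> by the fixed-point equation\<close>
     (\<forall>J. (\<forall>s\<in>X. \<forall>w\<in>Y. J s w = Jstar s w) \<longleftrightarrow>
        continuation_exists S J \<and> (\<forall>s\<in>X. \<forall>w\<in>Y. J s w = bellman S J s w)) \<and>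
     \<comment> \<open>optimality for the cost conditioned on a first shock at time 0\<close>
     (\<forall>\<mu>\<in>policies S.
        (\<forall>s\<in>X. \<forall>w\<in>Y. shock_cost S M \<tau> W \<mu> s w = Jstar s w) \<longleftrightarrow>
        (\<forall>s\<in>X. \<forall>w\<in>Y. achieves_minimum S Jstar \<mu> s w)) \<and>
     \<comment> \<open>optimality for the cost from an initial level, which ignores null sets of shock states;
        the full level has positive probability\<close>
     (\<forall>\<mu>\<in>policies S.
        optimal_policy S M \<tau> W \<mu> \<longleftrightarrow>
        (AE p in lborel \<Otimes>\<^sub>M size_law S.
           fst p \<in> X \<and> snd p \<in> Y \<longrightarrow> achieves_minimum S Jstar \<mu> (fst p) (snd p)) \<and>
        (AE w in size_law S. w \<in> Y \<longrightarrow> achieves_minimum S Jstar \<mu> (capacity S) w)) \<and>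
     \<comment> \<open>value iteration\<close>
     (\<forall>J0. continuation_exists S J0 \<longrightarrow>
        uniform_limit (X \<times> Y) (\<lambda>k (s, w). (bellman S ^^ k) J0 s w) (\<lambda>(s, w). Jstar s w) sequentially)"
proof -
  interpret storage_process S M \<tau> W
    by unfold_locales (rule assms(4), rule assms(5))
  obtain J where J: "regular J" "\<And>s w. s \<in> levels \<Longrightarrow> w \<in> sizes \<Longrightarrow> bellman S J s w = J s w"
    using bellman_fixed_point_exists by blast
  interpret solved_storage_process S M \<tau> W J
    by unfold_locales (use J in auto)
  show ?thesis
    unfolding X_def Y_def Jstar_def
    by (intro conjI allI ballI impI Jstar_eq(2) bellman_attains shock_cost_optimal_iff optimal_policy_iff
        Jstar_characterization regular_imp_continuation_exists[OF bellman_regular]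
        value_iteration_converges[OF Jstar_exists _ Jstar_fixed])
qed

end
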